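(* Let $m=\lfloor\frac n2\rfloor$ and fix $\eta\in\{j,k\}$. For any $n\times n$ quaternionic invertible matrix $G$, there exist an $n\times n$ quaternionic unitary matrix $U$, an $n\times n$ complex invertible matrix $V\in\mathrm{GL}(n,\mathbb{C})$, and $m$ unique (up to order and signs) real numbers $\theta_1,\dots,\theta_m$ such that $$G=U\,B_n^{\eta,\theta}\,V.$$
   Context: $\mathbb{H}$ denotes the real quaternions with imaginary units $i,j,k$; complex matrices are regarded as quaternionic matrices with entries in $\mathbb{R}+i\mathbb{R}$. A quaternionic matrix $U\in\mathbb{H}^{n\times n}$ is unitary if $U^DU=I_n$, where $(U^D)_{ab}=\overline{U_{ba}}$. $B_n^{\eta,\theta}$ is the $n\times n$ block diagonal matrix $\operatorname{diag}(B_1^\eta,\dots,B_m^\eta)$ if $n$ is even and $\operatorname{diag}(1,B_1^\eta,\dots,B_m^\eta)$ if $n$ is odd, where $$B_l^\eta=\begin{bmatrix}\cosh\theta_l & \eta\sinh\theta_l\\ -\eta\sinh\theta_l&\cosh\theta_l\end{bmatrix}.$$ *)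

theory Defs
  imports Complex_Main "HOL-Combinatorics.Permutations" "Jordan_Normal_Form.Matrix"
begin

section \<open>Quaternions\<close>

datatype quat = Quat (qRe: real) (qI: real) (qJ: real) (qK: real)

lemma quat_eq_iff: "x = y \<longleftrightarrow> qRe x = qRe y \<and> qI x = qI y \<and> qJ x = qJ y \<and> qK x = qK y"
  by (cases x; cases y) simp

instantiation quat :: real_div_algebra
begin

definition "0 = Quat 0 0 0 0"

definition "1 = Quat 1 0 0 0"

definition "x + y = Quat (qRe x + qRe y) (qI x + qI y) (qJ x + qJ y) (qK x + qK y)"

definition "x - y = Quat (qRe x - qRe y) (qI x - qI y) (qJ x - qJ y) (qK x - qK y)" for x y :: quat

definition "- x = Quat (- qRe x) (- qI x) (- qJ x) (- qK x)" for x :: quat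

definition "scaleR r x = Quat (r * qRe x) (r * qI x) (r * qJ x) (r * qK x)"

definition "x * y = Quat
  (qRe x * qRe y - qI x * qI y - qJ x * qJ y - qK x * qK y)
  (qRe x * qI y + qI x * qRe y + qJ x * qK y - qK x * qJ y)
  (qRe x * qJ y - qI x * qK y + qJ x * qRe y + qK x * qI y)
  (qRe x * qK y + qI x * qJ y - qJ x * qI y + qK x * qRe y)"

definition "inverse x = (let s = (qRe x)\<^sup>2 + (qI x)\<^sup>2 + (qJ x)\<^sup>2 + (qK x)\<^sup>2
  in Quat (qRe x / s) (- qI x / s) (- qJ x / s) (- qK x / s))"

definition "x div y = x * inverse y" for x y :: quat

lemmas quat_arith_defs = zero_quat_def one_quat_def plus_quat_def minus_quat_def
  uminus_quat_def scaleR_quat_def times_quat_def inverse_quat_def divide_quat_def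

instance
proof
  fix x :: quat
  assume x: "x \<noteq> 0"
  obtain a b c d where q: "x = Quat a b c d"
    by (cases x)
  define s where "s = a\<^sup>2 + b\<^sup>2 + c\<^sup>2 + d\<^sup>2"
  have s: "s \<noteq> 0"
  proof
    assume "s = 0"
    moreover have "a\<^sup>2 \<ge> 0" "b\<^sup>2 \<ge> 0" "c\<^sup>2 \<ge> 0" "d\<^sup>2 \<ge> 0"
      by auto
    ultimately have "a\<^sup>2 = 0" "b\<^sup>2 = 0" "c\<^sup>2 = 0" "d\<^sup>2 = 0"
      unfolding s_def by linarith+
    with x q show False
      by (simp add: zero_quat_def)
  qed
  have inv: "inverse x = Quat (a / s) (- b / s) (- c / s) (- d / s)"
    by (simp add: inverse_quat_def q s_def Let_def)
  have n: "a * a + b * b + c * c + d * d = s"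
    by (simp add: s_def power2_eq_square)
  show "inverse x * x = 1"
    unfolding inv unfolding q times_quat_def one_quat_def
    using s n by (simp add: field_simps)
  show "x * inverse x = 1"
    unfolding inv unfolding q times_quat_def one_quat_def
    using s n by (simp add: field_simps)
qed (simp_all add: quat_arith_defs Let_def algebra_simps quat_eq_iff)

end

definition quat_i :: quat where "quat_i = Quat 0 1 0 0"
definition quat_j :: quat where "quat_j = Quat 0 0 1 0"
definition quat_k :: quat where "quat_k = Quat 0 0 0 1"

lemma quat_units:
  "quat_i * quat_i = -1" "quat_j * quat_j = -1" "quat_k * quat_k = -1"
  "quat_i * quat_j = quat_k" "quat_j * quat_k = quat_i" "quat_k * quat_i = quat_j"
  "quat_j * quat_i = - quat_k" "quat_k * quat_j = - quat_i" "quat_i * quat_k = - quat_j"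
  by (simp_all add: quat_i_def quat_j_def quat_k_def quat_arith_defs)

definition quat_cnj :: "quat \<Rightarrow> quat" where
  "quat_cnj q = Quat (qRe q) (- qI q) (- qJ q) (- qK q)"

definition quat_of_complex :: "complex \<Rightarrow> quat" where
  "quat_of_complex z = Quat (Re z) (Im z) 0 0"

section \<open>Quaternionic matrices\<close>

definition qmat_adjoint :: "quat mat \<Rightarrow> quat mat" where
  "qmat_adjoint A = mat (dim_col A) (dim_row A) (\<lambda>(a, b). quat_cnj (A $$ (b, a)))"

definition quat_unitary :: "nat \<Rightarrow> quat mat \<Rightarrow> bool" where
  "quat_unitary n U \<longleftrightarrow> U \<in> carrier_mat n n \<and> qmat_adjoint U * U = 1\<^sub>m n"

definition B_block :: "quat \<Rightarrow> real \<Rightarrow> quat mat" where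
  "B_block \<eta> t = mat_of_rows_list 2
    [[of_real (cosh t), \<eta> * of_real (sinh t)],
     [- \<eta> * of_real (sinh t), of_real (cosh t)]]"

text \<open>The parameters are indexed from 1; only \<open>\<theta> 1, \<dots>, \<theta> (n div 2)\<close> matter.\<close>

definition B_mat :: "quat \<Rightarrow> nat \<Rightarrow> (nat \<Rightarrow> real) \<Rightarrow> quat mat" where
  "B_mat \<eta> n \<theta> = diag_block_mat
    ((if even n then [] else [1\<^sub>m 1]) @ map (\<lambda>l. B_block \<eta> (\<theta> l)) [1..<Suc (n div 2)])"

definition is_UBV_decomp ::
  "quat \<Rightarrow> nat \<Rightarrow> quat mat \<Rightarrow> quat mat \<Rightarrow> (nat \<Rightarrow> real) \<Rightarrow> complex mat \<Rightarrow> bool" where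
  "is_UBV_decomp \<eta> n G U \<theta> V \<longleftrightarrow>
     quat_unitary n U \<and> V \<in> carrier_mat n n \<and> invertible_mat V \<and>
     G = U * B_mat \<eta> n \<theta> * map_mat quat_of_complex V"

end

theory Submission
  imports Defs "HOL-Analysis.Function_Topology" "Jordan_Normal_Form.Char_Poly"
begin

text \<open>
  Write \<open>G\<^sup>D G = A + B \<eta>\<close> with complex \<open>A\<close>, \<open>B\<close>; then \<open>A\<close> is Hermitian positive definite and \<open>B\<close> is
  skew-symmetric. Let \<open>b\<close> be the bilinear form given by the conjugate of \<open>B\<close>. A pair \<open>x\<close>, \<open>y\<close> that
  maximises \<open>Re (b(x, y))\<close> over the \<open>A\<close>-unit ball of an \<open>A\<close>-orthogonal complement is \<open>A\<close>-orthonormal, and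
  the part of the complement that is \<open>A\<close>-orthogonal to it is also \<open>b\<close>-orthogonal to it (if the maximum
  is \<open>0\<close>, then \<open>b = 0\<close> there and any orthonormal pair will do);
  repeating this gives an \<open>A\<close>-orthonormal basis that brings \<open>B\<close> to
  \<open>2 \<times> 2\<close> block form with entries \<open>\<plusminus> s\<^sub>l\<close>. Positivity of the quaternionic form gives \<open>s\<^sub>l < 1\<close>, hence \<open>s\<^sub>l = tanh (2 \<theta>\<^sub>l)\<close>, and
  rescaling the basis turns \<open>G\<^sup>D G\<close> into \<open>B(2 \<theta>) = B(\<theta>)\<^sup>D B(\<theta>)\<close>.

  For uniqueness, two decompositions give \<open>W\<^sup>D B(2 \<theta>) W = B(2 \<theta>')\<close> with \<open>W\<close> complex. Conjugation by
  \<open>i\<close> fixes \<open>W\<close> and replaces \<open>\<theta>\<close> by \<open>- \<theta>\<close>, so that \<open>B(4 \<theta>) W = W B(4 \<theta>')\<close>. The complex part of \<open>B(4 \<theta>)\<close>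
  is diagonal with entries \<open>cosh (4 \<theta>\<^sub>l)\<close>, each occurring twice, and similar matrices have the same
  characteristic polynomial.
\<close>

section \<open>A Hermitian and a skew-symmetric form on complex vectors\<close>

text \<open>Vectors are functions on the naturals, so that continuity and compactness can be taken
  from the product topology.\<close>

definition sesq :: "nat \<Rightarrow> (nat \<Rightarrow> nat \<Rightarrow> complex) \<Rightarrow> (nat \<Rightarrow> complex) \<Rightarrow> (nat \<Rightarrow> complex) \<Rightarrow> complex" where
  "sesq n A x y = (\<Sum>p<n. \<Sum>q<n. cnj (x p) * A p q * y q)"

definition bilin :: "nat \<Rightarrow> (nat \<Rightarrow> nat \<Rightarrow> complex) \<Rightarrow> (nat \<Rightarrow> complex) \<Rightarrow> (nat \<Rightarrow> complex) \<Rightarrow> complex" where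
  "bilin n B x y = (\<Sum>p<n. \<Sum>q<n. x p * B p q * y q)"

section \<open>Linearity and continuity of the two forms\<close>

lemma sesq_linear:
  "sesq n A x (\<lambda>i. c * y i + d * z i) = c * sesq n A x y + d * sesq n A x z"
  "sesq n A (\<lambda>i. c * y i + d * z i) x = cnj c * sesq n A y x + cnj d * sesq n A z x"
  by (simp_all add: sesq_def algebra_simps sum.distrib sum_distrib_left)

lemma sesq_scale:
  "sesq n A x (\<lambda>i. c * y i) = c * sesq n A x y"
  "sesq n A (\<lambda>i. c * y i) x = cnj c * sesq n A y x"
  using sesq_linear(1)[of n A x c y 0 y] sesq_linear(2)[of n A c y 0 y x] by simp_all

lemma bilin_linear:
  "bilin n A x (\<lambda>i. c * y i + d * z i) = c * bilin n A x y + d * bilin n A x z"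
  "bilin n A (\<lambda>i. c * y i + d * z i) x = c * bilin n A y x + d * bilin n A z x"
  by (simp_all add: bilin_def algebra_simps sum.distrib sum_distrib_left)

lemma bilin_scale:
  "bilin n A x (\<lambda>i. c * y i) = c * bilin n A x y"
  "bilin n A (\<lambda>i. c * y i) x = c * bilin n A y x"
  using bilin_linear(1)[of n A x c y 0 y] bilin_linear(2)[of n A c y 0 y x] by simp_all

lemma continuous_on_sesq:
  "continuous_on UNIV (\<lambda>x. sesq n A (f x) (g x))"
  if "continuous_on UNIV f" "continuous_on UNIV g"
  unfolding sesq_def
  by (intro continuous_intros continuous_on_product_then_coordinatewise[OF that(1)]
      continuous_on_product_then_coordinatewise[OF that(2)])

lemma continuous_on_bilin:
  "continuous_on UNIV (\<lambda>x. bilin n A (f x) (g x))"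
  if "continuous_on UNIV f" "continuous_on UNIV g"
  unfolding bilin_def
  by (intro continuous_intros continuous_on_product_then_coordinatewise[OF that(1)]
      continuous_on_product_then_coordinatewise[OF that(2)])

text \<open>Padding the \<open>k\<close> equations with zero rows gives a square matrix whose last
  row vanishes. Its determinant is 0, so it has a nonzero kernel vector.\<close>

lemma underdetermined_system:
  fixes c :: "nat \<Rightarrow> nat \<Rightarrow> 'a::field"
  assumes "k < n"
  obtains x where "\<And>i. i \<ge> n \<Longrightarrow> x i = 0" "\<exists>i<n. x i \<noteq> 0"
    "\<And>l. l < k \<Longrightarrow> (\<Sum>i<n. c l i * x i) = 0"
proof -
  define M where "M = mat n n (\<lambda>(l, i). if l < k then c l i else 0)"
  have M: "M \<in> carrier_mat n n" by (simp add: M_def)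
  have "row M (n - 1) = 0\<^sub>v n" using assms by (auto simp: M_def)
  then have "M\<^sup>T *\<^sub>v unit_vec n (n - 1) = 0\<^sub>v n"
    using assms M by (auto simp: mult_mat_vec_def M_def)
  moreover have "unit_vec n (n - 1) \<noteq> (0\<^sub>v n :: 'a vec)" using assms by simp
  ultimately have "det M\<^sup>T = 0"
    using det_0_iff_vec_prod_zero_field[of "M\<^sup>T" n] M
    by (metis transpose_carrier_mat unit_vec_carrier)
  then have "det M = 0" using det_transpose[OF M] by simp
  then obtain v where v: "v \<in> carrier_vec n" "v \<noteq> 0\<^sub>v n" "M *\<^sub>v v = 0\<^sub>v n"
    using det_0_iff_vec_prod_zero_field[OF M] by auto
  define x where "x i = (if i < n then v $ i else 0)" for i
  show thesis
  proof
    show "x i = 0" if "i \<ge> n" for i using that by (simp add: x_def)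
    show "\<exists>i<n. x i \<noteq> 0" using v(1,2) by (auto simp: x_def vec_eq_iff)
    show "(\<Sum>i<n. c l i * x i) = 0" if "l < k" for l
    proof -
      have "(M *\<^sub>v v) $ l = 0" using v(3) that assms by simp
      moreover have "(M *\<^sub>v v) $ l = (\<Sum>i<n. c l i * x i)"
        using that assms v(1)
        by (auto simp: M_def scalar_prod_def x_def lessThan_atLeast0 intro!: sum.cong)
      ultimately show ?thesis by simp
    qed
  qed
qed

text \<open>Tychonoff: each coordinate ranges over a compact square, or over {0} from index
  \<open>n\<close> on.\<close>

lemma compact_box:
  fixes R :: real
  shows "compact {x::nat \<Rightarrow> complex. (\<forall>i\<ge>n. x i = 0) \<and> (\<forall>i<n. \<bar>Re (x i)\<bar> \<le> R \<and> \<bar>Im (x i)\<bar> \<le> R)}"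
proof -
  have "compact ((\<lambda>(u, v). of_real u + \<i> * of_real v) ` ({-R..R} \<times> {-R..R}))"
    by (intro compact_continuous_image compact_Times compact_Icc)
      (auto simp: case_prod_unfold intro!: continuous_intros)
  moreover have "(\<lambda>(u, v). of_real u + \<i> * of_real v) ` ({-R..R} \<times> {-R..R}) = {z. \<bar>Re z\<bar> \<le> R \<and> \<bar>Im z\<bar> \<le> R}"
  proof (intro equalityI subsetI)
    fix z assume "z \<in> {z. \<bar>Re z\<bar> \<le> R \<and> \<bar>Im z\<bar> \<le> R}"
    then show "z \<in> (\<lambda>(u, v). of_real u + \<i> * of_real v) ` ({-R..R} \<times> {-R..R})"
      by (intro image_eqI[of _ _ "(Re z, Im z)"]) (auto simp: complex_eq_iff)
  qed auto
  ultimately have sq: "compact {z. \<bar>Re z\<bar> \<le> R \<and> \<bar>Im z\<bar> \<le> R}" by simp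
  let ?S = "\<lambda>i. if i < n then {z. \<bar>Re z\<bar> \<le> R \<and> \<bar>Im z\<bar> \<le> R} else {0}"
  have "compact (?S i)" for i using sq by simp
  then have "compactin (product_topology (\<lambda>i. euclidean) UNIV) (PiE UNIV ?S)"
    unfolding compactin_PiE compactin_euclidean_iff by blast
  then have "compact (PiE UNIV ?S)"
    by (simp add: euclidean_product_topology)
  also have "PiE UNIV ?S = {x. (\<forall>i\<ge>n. x i = 0) \<and> (\<forall>i<n. \<bar>Re (x i)\<bar> \<le> R \<and> \<bar>Im (x i)\<bar> \<le> R)}"
    by (fastforce simp: PiE_def Pi_def split: if_splits)
  finally show ?thesis .
qed

text \<open>The index of the diagonal block of \<^const>\<open>B_mat\<close> that contains row \<open>i\<close>; it is \<open>0\<close> for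
  the leading \<open>1 \<times> 1\<close> block in odd dimension.\<close>

definition blk :: "nat \<Rightarrow> nat \<Rightarrow> nat" where
  "blk n i = (i + 2 - n mod 2) div 2"

text \<open>The skew-symmetric normal form: in each 2 x 2 block \<open>s\<close> stands above the
  diagonal and \<open>- s\<close> below. Block 0 is a single row and contributes only 0.\<close>

definition skew_entry :: "nat \<Rightarrow> (nat \<Rightarrow> real) \<Rightarrow> nat \<Rightarrow> nat \<Rightarrow> real" where
  "skew_entry n s i j =
    (if blk n i \<noteq> blk n j \<or> i = j then 0 else if i < j then s (blk n i) else - s (blk n i))"

lemma blk_shift: "n mod 2 \<le> i \<Longrightarrow> blk n i = (i - n mod 2) div 2 + 1"
proof -
  assume "n mod 2 \<le> i"
  then have "i + 2 - n mod 2 = (i - n mod 2) + 2" by simp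
  then show ?thesis by (simp add: blk_def)
qed

text \<open>To be applied with \<open>A\<close> the complex part of G^D G and \<open>B\<close> the
  conjugate of its second part. The symmetries come from self-adjointness of G^D G, positivity from
  invertibility of \<open>G\<close>.\<close>

locale hermitian_skew_pair =
  fixes n :: nat and A B :: "nat \<Rightarrow> nat \<Rightarrow> complex"
  assumes hermitian: "p < n \<Longrightarrow> q < n \<Longrightarrow> A q p = cnj (A p q)"
    and skew: "p < n \<Longrightarrow> q < n \<Longrightarrow> B q p = - B p q"
    and pos_def: "\<exists>i<n. x i \<noteq> 0 \<Longrightarrow> 0 < Re (sesq n A x x)"
begin

abbreviation "a \<equiv> sesq n A"
abbreviation "b \<equiv> bilin n B"

section \<open>Symmetry and positivity of the two forms\<close>

lemma a_commute: "a y x = cnj (a x y)"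
proof -
  have "cnj (a x y) = (\<Sum>p<n. \<Sum>q<n. cnj (y q) * A q p * x p)"
    unfolding sesq_def cnj_sum
  proof (intro sum.cong refl)
    fix p q assume "p \<in> {..<n}" "q \<in> {..<n}"
    then show "cnj (cnj (x p) * A p q * y q) = cnj (y q) * A q p * x p"
      using hermitian[of p q] by simp
  qed
  also have "\<dots> = a y x" unfolding sesq_def by (rule sum.swap)
  finally show ?thesis by simp
qed

lemma b_commute: "b y x = - b x y"
proof -
  have "- b x y = (\<Sum>p<n. \<Sum>q<n. y q * B q p * x p)"
    unfolding bilin_def sum_negf[symmetric]
  proof (intro sum.cong refl)
    fix p q assume "p \<in> {..<n}" "q \<in> {..<n}"
    then show "- (x p * B p q * y q) = y q * B q p * x p"
      using skew[of p q] by simp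
  qed
  also have "\<dots> = b y x" unfolding bilin_def by (rule sum.swap)
  finally show ?thesis by simp
qed

lemma b_self [simp]: "b x x = 0"
  using b_commute[of x x] by simp

lemma a_self_Im [simp]: "Im (a x x) = 0"
  using arg_cong[OF a_commute[of x x], of Im] by simp

lemma a_self_nonneg: "0 \<le> Re (a x x)"
proof (cases "\<exists>i<n. x i \<noteq> 0")
  case True
  then show ?thesis using pos_def[of x] by simp
next
  case False
  then show ?thesis by (simp add: sesq_def)
qed

text \<open>Requiring zeros from index \<open>n\<close> on identifies \<open>orth {}\<close> with
  C^n and keeps bounded parts of \<open>orth F\<close> compact.\<close>

definition orth :: "(nat \<Rightarrow> complex) set \<Rightarrow> (nat \<Rightarrow> complex) set" where
  "orth F = {x. (\<forall>i\<ge>n. x i = 0) \<and> (\<forall>f\<in>F. a f x = 0)}"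

lemma orth_linear: "x \<in> orth F \<Longrightarrow> y \<in> orth F \<Longrightarrow> (\<lambda>i. c * x i + d * y i) \<in> orth F"
  by (auto simp: orth_def sesq_linear)

lemma orth_scale: "x \<in> orth F \<Longrightarrow> (\<lambda>i. c * x i) \<in> orth F"
  by (auto simp: orth_def sesq_scale)

lemma orth_zero: "(\<lambda>i. 0) \<in> orth F"
  by (auto simp: orth_def sesq_def)

lemma orth_pos: "x \<in> orth F \<Longrightarrow> x \<noteq> (\<lambda>i. 0) \<Longrightarrow> 0 < Re (a x x)"
  by (rule pos_def) (unfold orth_def fun_eq_iff, use leI in blast)

text \<open>Orthogonality to \<open>F\<close> is a system of \<open>card F\<close> linear equations
  in \<open>n\<close> unknowns; a nonzero solution is normalised with respect to
  \<open>a\<close>.\<close>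

lemma ex_unit_orth:
  assumes "finite F" "card F < n"
  obtains x where "x \<in> orth F" "a x x = 1"
proof -
  obtain f where f: "bij_betw f {..<card F} F"
    using assms(1) by (metis lessThan_atLeast0 ex_bij_betw_nat_finite)
  obtain y where y: "\<And>i. i \<ge> n \<Longrightarrow> y i = 0" "\<exists>i<n. y i \<noteq> 0"
    "\<And>l. l < card F \<Longrightarrow> (\<Sum>i<n. (\<Sum>p<n. cnj (f l p) * A p i) * y i) = 0"
    by (rule underdetermined_system[OF assms(2), of "\<lambda>l i. \<Sum>p<n. cnj (f l p) * A p i"]) (rule that)
  have 0: "a (f l) y = 0" if "l < card F" for l
    using y(3)[OF that] unfolding sesq_def sum_distrib_right
    by (subst sum.swap) simp
  have "a g y = 0" if "g \<in> F" for g
  proof -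
    have "g \<in> f ` {..<card F}" using that f by (simp add: bij_betw_def)
    then obtain l where "l < card F" "g = f l" by blast
    then show ?thesis using 0 by simp
  qed
  then have yW: "y \<in> orth F"
    unfolding orth_def using y(1) by simp
  define r where "r = Re (a y y)"
  have r: "0 < r" using pos_def[OF y(2)] by (simp add: r_def)
  have ay: "a y y = of_real r" by (simp add: complex_eq_iff r_def)
  define u where "u = 1 / sqrt r"
  have u: "u * (u * r) = 1" using r by (simp add: u_def)
  have "a (\<lambda>i. of_real u * y i) (\<lambda>i. of_real u * y i) = 1"
    unfolding sesq_scale ay using u by (simp flip: of_real_mult)
  then show thesis using that orth_scale[OF yW] by blast
qed

text \<open>By positive definiteness the form dominates a positive multiple of the Euclidean norm.
  The ball is therefore a closed subset of a compact box.\<close>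

lemma compact_ball_orth: "compact {x \<in> orth F. Re (a x x) \<le> 1}"
proof (cases "n = 0")
  case True
  have "{x \<in> orth F. Re (a x x) \<le> 1} \<subseteq> {\<lambda>i. 0}"
    unfolding orth_def using True by auto
  then show ?thesis by (intro finite_imp_compact) (rule finite_subset, auto)
next
  case False
  define N :: "(nat \<Rightarrow> complex) \<Rightarrow> real" where "N x = (\<Sum>i<n. (norm (x i))\<^sup>2)" for x
  have contN: "continuous_on UNIV N" unfolding N_def
    by (intro continuous_intros continuous_on_product_coordinates)
  have contA: "continuous_on UNIV (\<lambda>x. Re (a x x))"
    by (intro continuous_intros continuous_on_sesq continuous_on_id)
  let ?box = "\<lambda>R. {x::nat \<Rightarrow> complex. (\<forall>i\<ge>n. x i = 0) \<and> (\<forall>i<n. \<bar>Re (x i)\<bar> \<le> R \<and> \<bar>Im (x i)\<bar> \<le> R)}"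
  have le_N: "(norm (x i))\<^sup>2 \<le> N x" if "i < n" for x i
    unfolding N_def using that by (intro member_le_sum) auto
  let ?S = "{x. (\<forall>i\<ge>n. x i = 0) \<and> N x = 1}"
  have "closed {x. N x = 1}"
    using closed_Collect_eq[OF contN continuous_on_const] by simp
  then have "compact (?box 1 \<inter> {x. N x = 1})"
    using compact_box by blast
  moreover have "?box 1 \<inter> {x. N x = 1} = ?S"
  proof -
    have "\<bar>Re (x i)\<bar> \<le> 1 \<and> \<bar>Im (x i)\<bar> \<le> 1" if "N x = 1" "i < n" for x i
    proof -
      have "norm (x i) \<le> 1"
        using le_N[OF that(2), of x] that(1) by (simp add: abs_square_le_1)
      then show ?thesis
        using abs_Re_le_cmod[of "x i"] abs_Im_le_cmod[of "x i"] by linarith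
    qed
    then show ?thesis by blast
  qed
  ultimately have S: "compact ?S" by simp
  have "N (\<lambda>i. if i = 0 then 1 else 0) = (\<Sum>i<n. if i = 0 then 1 else 0)"
    unfolding N_def by (rule sum.cong) auto
  also have "\<dots> = 1" using False by simp
  finally have "(\<lambda>i. if i = 0 then 1 else 0) \<in> ?S" using False by simp
  then have "?S \<noteq> {}" by (metis (lifting) empty_iff)
  from continuous_attains_inf[OF S this continuous_on_subset[OF contA subset_UNIV]]
  obtain u where u: "u \<in> ?S" "\<And>x. x \<in> ?S \<Longrightarrow> Re (a u u) \<le> Re (a x x)"
    by (elim bexE) (rule that, assumption, erule (1) bspec)
  \<comment> \<open>The minimum of the form on the Euclidean unit sphere, that is, the smallest
    eigenvalue of \<open>A\<close>.\<close>
  define c where "c = Re (a u u)"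
  have "\<exists>i<n. u i \<noteq> 0" 
  proof (rule ccontr)
    assume "\<not> ?thesis"
    then have "N u = 0" by (simp add: N_def)
    then show False using u(1) by simp
  qed
  then have c: "0 < c" unfolding c_def by (rule pos_def)
  \<comment> \<open>The minimum on the sphere extends to all vectors by homogeneity of degree
    2.\<close>
  have bound: "c * N x \<le> Re (a x x)" if x: "\<forall>i\<ge>n. x i = 0" for x
  proof (cases "N x = 0")
    case True
    then show ?thesis using a_self_nonneg by simp
  next
    case False
    moreover have "0 \<le> N x" unfolding N_def by (intro sum_nonneg) simp
    ultimately have pos: "0 < N x" by simp
    define r where "r = 1 / sqrt (N x)"
    have r: "r\<^sup>2 * N x = 1" using pos by (simp add: r_def power_divide)
    have "N (\<lambda>i. of_real r * x i) = r\<^sup>2 * N x"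
      unfolding N_def by (simp add: norm_mult power_mult_distrib sum_distrib_left)
    then have "(\<lambda>i. of_real r * x i) \<in> ?S" using x r by simp
    from u(2)[OF this] have "c \<le> r\<^sup>2 * Re (a x x)"
      unfolding c_def sesq_scale by (simp add: power2_eq_square mult.assoc)
    then have "c * N x \<le> (r\<^sup>2 * Re (a x x)) * N x"
      using pos by (intro mult_right_mono) auto
    also have "\<dots> = (r\<^sup>2 * N x) * Re (a x x)" by simp
    finally show ?thesis using r by simp
  qed
  have eq: "{x \<in> orth F. Re (a x x) \<le> 1} = ?box (sqrt (1 / c)) \<inter> ({x. \<forall>f\<in>F. a f x = 0} \<inter> {x. Re (a x x) \<le> 1})"
  proof -
    have "\<bar>Re (x i)\<bar> \<le> sqrt (1 / c) \<and> \<bar>Im (x i)\<bar> \<le> sqrt (1 / c)" if "\<forall>i\<ge>n. x i = 0" "Re (a x x) \<le> 1" "i < n" for x i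
    proof -
      have "c * (norm (x i))\<^sup>2 \<le> 1"
        using bound[OF that(1)] that(2) mult_left_mono[OF le_N[OF that(3), of x], of c] c by linarith
      then have "norm (x i) \<le> sqrt (1 / c)" using c by (intro real_le_rsqrt) (simp add: field_simps)
      then show ?thesis
        using abs_Re_le_cmod[of "x i"] abs_Im_le_cmod[of "x i"] by linarith
    qed
    then show ?thesis unfolding orth_def by blast
  qed
  have cl1: "closed {x. \<forall>f\<in>F. a f x = 0}"
  proof -
    have "closed {x. a f x = 0}" for f
      by (intro closed_Collect_eq continuous_on_sesq continuous_intros)
    moreover have "{x. \<forall>f\<in>F. a f x = 0} = (\<Inter>f\<in>F. {x. a f x = 0})" by auto
    ultimately show ?thesis by auto
  qed
  have cl2: "closed {x. Re (a x x) \<le> 1}"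
    using closed_Collect_le[OF contA continuous_on_const] by simp
  show ?thesis unfolding eq by (intro compact_Int_closed compact_box closed_Int cl1 cl2)
qed

text \<open>Both arguments are rescaled to norm 1, where the assumed bound applies. A zero vector
  cannot be rescaled, but there both sides vanish.\<close>

lemma b_bound_scaled:
  assumes max: "\<And>x y. x \<in> orth F \<Longrightarrow> y \<in> orth F \<Longrightarrow> Re (a x x) \<le> 1 \<Longrightarrow> Re (a y y) \<le> 1 \<Longrightarrow> Re (b x y) \<le> s"
    and x: "x \<in> orth F" and y: "y \<in> orth F"
  shows "Re (b x y) \<le> s * (sqrt (Re (a x x)) * sqrt (Re (a y y)))"
proof (cases "x = (\<lambda>i. 0) \<or> y = (\<lambda>i. 0)")
  case True
  then show ?thesis by (auto simp: bilin_def sesq_def)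
next
  case False
  define r t where "r = sqrt (Re (a x x))" and "t = sqrt (Re (a y y))"
  have r: "0 < r" "r\<^sup>2 = Re (a x x)" and t: "0 < t" "t\<^sup>2 = Re (a y y)"
    using orth_pos[OF x] orth_pos[OF y] False by (auto simp: r_def t_def)
  have sc: "Re (a (\<lambda>i. of_real (inverse u) * z i) (\<lambda>i. of_real (inverse u) * z i)) \<le> 1"
    if "0 < u" "u\<^sup>2 = Re (a z z)" for u z
    using that by (simp add: sesq_scale flip: that(2) of_real_inverse) (simp add: power2_eq_square field_simps)
  have "Re (b (\<lambda>i. of_real (inverse r) * x i) (\<lambda>i. of_real (inverse t) * y i)) \<le> s"
    by (intro max orth_scale x y sc r t)
  then have "inverse r * inverse t * Re (b x y) \<le> s"
    unfolding bilin_scale by (simp add: mult_ac flip: of_real_inverse)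
  then show ?thesis using r(1) t(1) unfolding r_def[symmetric] t_def[symmetric]
    by (simp add: field_simps)
qed

text \<open>A first-order optimality condition without derivatives: along multiples of the conjugate
  of \<beta> the left side grows linearly and the right side only quadratically.\<close>

lemma vanishes_if_quadratically_bounded:
  fixes \<beta> :: complex and s g :: real
  assumes "0 < s" and bound: "\<And>t. s + Re (t * \<beta>) \<le> s * sqrt (1 + (norm t)\<^sup>2 * g)" and "0 \<le> g"
  shows "\<beta> = 0"
proof (rule ccontr)
  assume "\<beta> \<noteq> 0"
  define m where "m = (norm \<beta>)\<^sup>2"
  have m: "0 < m" using \<open>\<beta> \<noteq> 0\<close> by (simp add: m_def)
  \<comment> \<open>This step length is short enough that, after squaring, the quadratic term on the
    right is at most half of the cross term \<open>2 * (s * (r * m))\<close> on the left.\<close>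
  define r where "r = inverse (s * g + 1)"
  have sg: "0 < s * g + 1" using assms(1,3) by (simp add: add_nonneg_pos)
  then have r: "0 < r" "r * (s * g) < 1" by (auto simp: r_def field_simps)
  have "Re (of_real r * cnj \<beta> * \<beta>) = r * m"
    unfolding m_def cmod_power2 by (simp add: power2_eq_square algebra_simps)
  moreover have "(norm (of_real r * cnj \<beta>))\<^sup>2 = r\<^sup>2 * m"
    using r(1) by (simp add: m_def norm_mult power_mult_distrib)
  ultimately have le: "s + r * m \<le> s * sqrt (1 + r\<^sup>2 * m * g)"
    using bound[of "of_real r * cnj \<beta>"] by simp
  have nn: "0 \<le> r\<^sup>2 * m * g" using m assms(3) by simp
  have "(s + r * m)\<^sup>2 \<le> (s * sqrt (1 + r\<^sup>2 * m * g))\<^sup>2"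
    by (rule power_mono[OF le]) (use assms(1) r m in simp)
  also have "\<dots> = s\<^sup>2 * (1 + r\<^sup>2 * m * g)"
    using nn by (simp add: power_mult_distrib)
  finally have "2 * (s * (r * m)) + (r * m)\<^sup>2 \<le> (s * (r * m)) * (r * (s * g))"
    by (simp add: power2_eq_square algebra_simps)
  also have "\<dots> \<le> s * (r * m)"
    using r m assms(1) by (intro mult_left_le) auto
  finally have "s * (r * m) + (r * m)\<^sup>2 \<le> 0" by linarith
  moreover have "0 < s * (r * m)" using assms(1) r m by simp
  ultimately show False using zero_le_power2[of "r * m"] by linarith
qed

text \<open>By compactness the real part of \<open>b\<close> attains its maximum \<open>s\<close> on
  pairs from the unit ball of \<open>orth F\<close>. If \<open>s\<close> is positive, every listed
  property follows from maximality, by varying one vector at a time.\<close>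

lemma ex_extremal_pair:
  assumes "finite F" "card F + 2 \<le> n"
  obtains x y s where "x \<in> orth F" "y \<in> orth F" "a x x = 1" "a y y = 1" "a x y = 0"
    "0 \<le> s" "b x y = of_real s"
    "\<And>w. w \<in> orth F \<Longrightarrow> a y w = 0 \<Longrightarrow> b x w = 0"
    "\<And>w. w \<in> orth F \<Longrightarrow> a x w = 0 \<Longrightarrow> b y w = 0"
proof -
  let ?K = "{x \<in> orth F. Re (a x x) \<le> 1}"
  have "compact (?K \<times> ?K)" by (intro compact_Times compact_ball_orth)
  moreover have "((\<lambda>i. 0), (\<lambda>i. 0)) \<in> ?K \<times> ?K"
    using orth_zero by (auto simp: sesq_def)
  then have "?K \<times> ?K \<noteq> {}" by (metis (lifting) empty_iff)
  moreover have "continuous_on (?K \<times> ?K) (\<lambda>z. Re (b (fst z) (snd z)))"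
    by (rule continuous_on_subset[OF _ subset_UNIV])
      (intro continuous_intros continuous_on_bilin)
  ultimately have "\<exists>z\<in>?K \<times> ?K. \<forall>z'\<in>?K \<times> ?K. Re (b (fst z') (snd z')) \<le> Re (b (fst z) (snd z))"
    by (rule continuous_attains_sup)
  then obtain x y where xy: "x \<in> orth F" "y \<in> orth F" "Re (a x x) \<le> 1" "Re (a y y) \<le> 1"
    and max0: "\<And>x' y'. x' \<in> orth F \<Longrightarrow> y' \<in> orth F \<Longrightarrow> Re (a x' x') \<le> 1 \<Longrightarrow> Re (a y' y') \<le> 1
      \<Longrightarrow> Re (b x' y') \<le> Re (b x y)"
    by fastforce
  define s where "s = Re (b x y)"
  have max: "Re (b u w) \<le> s * (sqrt (Re (a u u)) * sqrt (Re (a w w)))" if "u \<in> orth F" "w \<in> orth F" for u w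
    by (rule b_bound_scaled[OF _ that]) (unfold s_def, rule max0)
  have "0 \<le> s"
    using max0[OF orth_zero orth_zero] by (simp add: s_def sesq_def bilin_def)
  show thesis
  proof (cases "s = 0")
    case True
    have b0: "b u w = 0" if "u \<in> orth F" "w \<in> orth F" for u w
    proof -
      have "Re (c * b u w) \<le> 0" for c
        using max[OF orth_scale[OF that(1)] that(2), of c] True by (simp add: bilin_scale)
      \<comment> \<open>The four fourth roots of unity bound the real and imaginary parts from both
        sides.\<close>
      from this[of 1] this[of "-1"] this[of "\<i>"] this[of "-\<i>"] show ?thesis
        by (simp add: complex_eq_iff)
    qed
    obtain x1 where x1: "x1 \<in> orth F" "a x1 x1 = 1"
      using ex_unit_orth[of F] assms by auto
    have "card (insert x1 F) < n" "finite (insert x1 F)"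
      using assms card_insert_le_m1[of "Suc (card F)" F x1] by auto
    then obtain y1 where y1: "y1 \<in> orth (insert x1 F)" "a y1 y1 = 1"
      using ex_unit_orth[of "insert x1 F"] by auto
    then have "y1 \<in> orth F" "a x1 y1 = 0" by (auto simp: orth_def)
    then show thesis
      using that[of x1 y1 0] x1 y1 b0 by simp
  next
    case False
    then have s: "0 < s" using \<open>0 \<le> s\<close> by simp
    define p q where "p = sqrt (Re (a x x))" and "q = sqrt (Re (a y y))"
    have pq: "0 \<le> p" "0 \<le> q" "p \<le> 1" "q \<le> 1"
      using a_self_nonneg xy(3,4) by (auto simp: p_def q_def)
    \<comment> \<open>The scaled bound applied to the maximising pair itself; with norms at most 1
      it forces both norms to be 1.\<close>
    have "s * 1 \<le> s * (p * q)"
      using max[OF xy(1,2)] by (simp add: s_def p_def q_def)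
    then have "1 \<le> p * q" using s by simp
    moreover have "p * q \<le> p" "p * q \<le> q" using pq by (auto intro: mult_left_le mult_left_le_one_le)
    ultimately have "p = 1" "q = 1" using pq by linarith+
    then have xx: "a x x = 1" and yy: "a y y = 1"
      by (auto simp: p_def q_def complex_eq_iff)
    \<comment> \<open>Moving \<open>v\<close> to \<open>v + t * w\<close> changes its squared norm
      only to second order in \<open>t\<close>, as \<open>w\<close> is orthogonal to
      \<open>v\<close>, but changes the value of \<open>b\<close> to first order. The pair is kept
      general, for use with (x, y) and with (y, -x).\<close>
    have key: "b u w = 0" if u: "u \<in> orth F" "v \<in> orth F" "w \<in> orth F" "a u u = 1" "a v v = 1"
      "Re (b u v) = s" "a v w = 0" for u v w
    proof (rule vanishes_if_quadratically_bounded[OF s, of _ "Re (a w w)"])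
      fix t
      have wv: "a w v = 0" using a_commute[of w v] u(7) by simp
      let ?z = "\<lambda>i. 1 * v i + t * w i"
      have "Re (a ?z ?z) = 1 + (norm t)\<^sup>2 * Re (a w w)"
        unfolding sesq_linear u(5,7) wv cmod_power2
        by (simp add: power2_eq_square algebra_simps)
      moreover have "Re (b u ?z) = s + Re (t * b u w)"
        unfolding bilin_linear using u(6) by simp
      ultimately show "s + Re (t * b u w) \<le> s * sqrt (1 + (norm t)\<^sup>2 * Re (a w w))"
        using max[OF u(1) orth_linear[OF u(2,3)], of 1 t] u(4) by simp
    qed (rule a_self_nonneg)
    have b1: "b x w = 0" if "w \<in> orth F" "a y w = 0" for w
      using key[OF xy(1,2) that(1) xx yy _ that(2)] s_def by simp
    have b2: "b y w = 0" if "w \<in> orth F" "a x w = 0" for w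
    proof -
      \<comment> \<open>By skew-symmetry the pair (y, -x) attains the same maximum, so the variation
        applies to it too.\<close>
      have "(\<lambda>i. -1 * x i) \<in> orth F" using orth_scale[OF xy(1)] .
      moreover have "a (\<lambda>i. -1 * x i) (\<lambda>i. -1 * x i) = 1" unfolding sesq_scale xx by simp
      moreover have "Re (b y (\<lambda>i. -1 * x i)) = s"
        unfolding bilin_scale by (simp add: s_def b_commute[of y x])
      moreover have "a (\<lambda>i. -1 * x i) w = 0" unfolding sesq_scale that(2) by simp
      ultimately show ?thesis using key[OF xy(2) _ that(1) yy] by blast
    qed
    have bs: "b x y = of_real s"
    proof -
      \<comment> \<open>Rotating \<open>y\<close> by the phase that makes \<open>b x y\<close> real
        gives |b(x, y)| \<le> \<open>s\<close> = Re b(x, y), so the imaginary part is 0.\<close>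
      let ?t = "cnj (b x y)"
      have "Re (b x (\<lambda>i. ?t * y i)) \<le> s * (sqrt (Re (a x x)) * sqrt (Re (a (\<lambda>i. ?t * y i) (\<lambda>i. ?t * y i))))"
        by (rule max[OF xy(1) orth_scale[OF xy(2)]])
      then have "(norm (b x y))\<^sup>2 \<le> s * norm (b x y)"
        unfolding bilin_scale sesq_scale xx yy by (simp add: cmod_def power2_eq_square)
      then have "norm (b x y) \<le> s"
        using s by (cases "b x y = 0") (auto simp: power2_eq_square)
      then have "(norm (b x y))\<^sup>2 \<le> s\<^sup>2" by (intro power_mono) auto
      then have "Im (b x y) = 0" by (simp add: cmod_power2 s_def)
      then show ?thesis by (simp add: complex_eq_iff s_def)
    qed
    have "a x y = 0"
    proof -
      \<comment> \<open>The component of \<open>x\<close> orthogonal to \<open>y\<close>. As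
        \<open>b x x\<close> is 0, pairing it with \<open>x\<close> leaves only the multiple
        \<open>- a y x\<close> of \<open>b x y\<close>.\<close>
      let ?w = "\<lambda>i. 1 * x i + (- a y x) * y i"
      have "a y ?w = 0" unfolding sesq_linear yy by simp
      then have "b x ?w = 0" using b1[OF orth_linear[OF xy(1,2)]] by blast
      then have "a y x * b x y = 0" unfolding bilin_linear by simp
      then have "a y x = 0" using bs s by simp
      then show ?thesis using a_commute[of x y] by simp
    qed
    then show thesis using that[of x y s] xy xx yy b1 b2 bs s by simp
  qed
qed

text \<open>The \<open>l\<close>-th pair has indices \<open>2 * l\<close> and
  \<open>2 * l + 1\<close>. The last clause, that whatever is \<open>a\<close>-orthogonal to the
  family is also \<open>b\<close>-orthogonal to it, carries the induction.\<close>

definition canonical_family :: "nat \<Rightarrow> (nat \<Rightarrow> nat \<Rightarrow> complex) \<Rightarrow> (nat \<Rightarrow> real) \<Rightarrow> bool" where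
  "canonical_family k v s \<longleftrightarrow>
    (\<forall>i<2 * k. v i \<in> orth {}) \<and>
    (\<forall>i<2 * k. \<forall>j<2 * k. a (v i) (v j) = (if i = j then 1 else 0)) \<and>
    (\<forall>i<2 * k. \<forall>j<2 * k. i div 2 \<noteq> j div 2 \<longrightarrow> b (v i) (v j) = 0) \<and>
    (\<forall>l<k. 0 \<le> s l \<and> b (v (2 * l)) (v (2 * l + 1)) = of_real (s l)) \<and>
    (\<forall>w\<in>orth (v ` {..<2 * k}). \<forall>i<2 * k. b (v i) w = 0)"

text \<open>The next extremal pair is chosen in the complement of the family built so far. The last
  clause of \<open>canonical_family\<close> makes it \<open>b\<close>-orthogonal to the earlier
  vectors, and its extremality renews that clause.\<close>

lemma ex_canonical_family:
  assumes "2 * k \<le> n"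
  shows "\<exists>v s. canonical_family k v s"
  using assms
proof (induction k)
  case 0
  then show ?case by (simp add: canonical_family_def)
next
  case (Suc k)
  then obtain v s where C: "canonical_family k v s" by auto
  have V: "v i \<in> orth {}" if "i < 2 * k" for i
    using C that unfolding canonical_family_def by simp
  have aV: "a (v i) (v j) = (if i = j then 1 else 0)" if "i < 2 * k" "j < 2 * k" for i j
    using C that unfolding canonical_family_def by simp
  have bV: "b (v i) (v j) = 0" if "i < 2 * k" "j < 2 * k" "i div 2 \<noteq> j div 2" for i j
    using C that unfolding canonical_family_def by simp
  have sV: "0 \<le> s l \<and> b (v (2 * l)) (v (2 * l + 1)) = of_real (s l)" if "l < k" for l
    using C that unfolding canonical_family_def by simp
  have perp: "b (v i) w = 0" if "w \<in> orth (v ` {..<2 * k})" "i < 2 * k" for w i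
    using C that unfolding canonical_family_def by simp
  let ?F = "v ` {..<2 * k}"
  have "card ?F \<le> 2 * k" using card_image_le[of "{..<2 * k}" v] by simp
  then have "card ?F + 2 \<le> n" using Suc.prems by simp
  obtain x y t where xF: "x \<in> orth ?F" and yF: "y \<in> orth ?F"
    and xy: "a x x = 1" "a y y = 1" "a x y = 0" "0 \<le> t" "b x y = of_real t"
    and bx: "\<And>w. w \<in> orth ?F \<Longrightarrow> a y w = 0 \<Longrightarrow> b x w = 0"
    and "by": "\<And>w. w \<in> orth ?F \<Longrightarrow> a x w = 0 \<Longrightarrow> b y w = 0"
    by (rule ex_extremal_pair[OF _ \<open>card ?F + 2 \<le> n\<close>]) (simp, rule that)
  have yx: "a y x = 0" using a_commute[of y x] xy(3) by simp
  have av: "a (v i) x = 0" "a (v i) y = 0" "a x (v i) = 0" "a y (v i) = 0" if "i < 2 * k" for i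
  proof -
    show "a (v i) x = 0" "a (v i) y = 0" using xF yF that by (auto simp: orth_def)
    then show "a x (v i) = 0" "a y (v i) = 0" using a_commute[of _ "v i"] by auto
  qed
  have bv: "b (v i) x = 0" "b (v i) y = 0" "b x (v i) = 0" "b y (v i) = 0" if "i < 2 * k" for i
  proof -
    show "b (v i) x = 0" "b (v i) y = 0" using perp[OF xF that] perp[OF yF that] .
    then show "b x (v i) = 0" "b y (v i) = 0" using b_commute[of _ "v i"] by auto
  qed
  define v' where "v' = v(2 * k := x, 2 * k + 1 := y)"
  define s' where "s' = s(k := t)"
  have split: "i < 2 * k \<or> i = 2 * k \<or> i = 2 * k + 1" if "i < 2 * Suc k" for i
    using that by presburger
  have old [simp]: "v' i = v i" if "i < 2 * k" for i using that by (simp add: v'_def)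
  have new [simp]: "v' (2 * k) = x" "v' (Suc (2 * k)) = y" by (simp_all add: v'_def)
  have sub: "orth G \<subseteq> orth {}" for G by (auto simp: orth_def)
  have "\<forall>i<2 * Suc k. v' i \<in> orth {}"
  proof (intro allI impI)
    fix i assume "i < 2 * Suc k"
    from split[OF this] show "v' i \<in> orth {}"
      using V xF yF sub[of ?F] by (elim disjE) auto
  qed
  moreover have "\<forall>i<2 * Suc k. \<forall>j<2 * Suc k. a (v' i) (v' j) = (if i = j then 1 else 0)"
  proof (intro allI impI)
    fix i j assume "i < 2 * Suc k" "j < 2 * Suc k"
    from split[OF this(1)] split[OF this(2)] show "a (v' i) (v' j) = (if i = j then 1 else 0)"
      by (elim disjE) (simp_all add: aV av xy yx)
  qed
  moreover have "\<forall>i<2 * Suc k. \<forall>j<2 * Suc k. i div 2 \<noteq> j div 2 \<longrightarrow> b (v' i) (v' j) = 0"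
  proof (intro allI impI)
    fix i j assume ij: "i < 2 * Suc k" "j < 2 * Suc k" and d: "i div 2 \<noteq> j div 2"
    from split[OF ij(1)] split[OF ij(2)] d show "b (v' i) (v' j) = 0"
      by (elim disjE) (simp_all add: bV bv)
  qed
  moreover have "\<forall>l<Suc k. 0 \<le> s' l \<and> b (v' (2 * l)) (v' (2 * l + 1)) = of_real (s' l)"
  proof (intro allI impI)
    fix l assume "l < Suc k"
    then consider "l < k" | "l = k" by linarith
    then show "0 \<le> s' l \<and> b (v' (2 * l)) (v' (2 * l + 1)) = of_real (s' l)"
    proof cases
      case 1
      then have "v' (2 * l) = v (2 * l)" "v' (2 * l + 1) = v (2 * l + 1)" by (intro old; simp)+
      then show ?thesis using sV[OF 1] 1 by (simp add: s'_def)
    next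
      case 2
      then show ?thesis using xy by (simp add: s'_def)
    qed
  qed
  moreover have "\<forall>w\<in>orth (v' ` {..<2 * Suc k}). \<forall>i<2 * Suc k. b (v' i) w = 0"
  proof (intro ballI allI impI)
    fix w i assume w: "w \<in> orth (v' ` {..<2 * Suc k})" and i: "i < 2 * Suc k"
    have w0: "a (v' j) w = 0" if "j < 2 * Suc k" for j
      using w that by (simp add: orth_def)
    have "a (v j) w = 0" if "j < 2 * k" for j
      using w0[of j] that by simp
    moreover have "w p = 0" if "p \<ge> n" for p using w that by (simp add: orth_def)
    ultimately have wF: "w \<in> orth ?F" by (auto simp: orth_def)
    have "a x w = 0" "a y w = 0" using w0[of "2 * k"] w0[of "2 * k + 1"] by simp_all
    then show "b (v' i) w = 0"
      using split[OF i] perp[OF wF] bx[OF wF] "by"[OF wF] by auto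
  qed
  ultimately have "canonical_family (Suc k) v' s'"
    unfolding canonical_family_def by (intro conjI)
  then show ?case by blast
qed

theorem ex_canonical_basis:
  obtains u s where
    "\<And>i j. i < n \<Longrightarrow> j < n \<Longrightarrow> a (u i) (u j) = (if i = j then 1 else 0)"
    "\<And>i j. i < n \<Longrightarrow> j < n \<Longrightarrow> b (u i) (u j) = of_real (skew_entry n s i j)"
    "\<And>l. l \<in> {1..n div 2} \<Longrightarrow> 0 \<le> s l"
proof -
  define e k where "e = n mod 2" and "k = n div 2"
  have n: "n = 2 * k + e" and e: "e < 2" by (simp_all add: e_def k_def)
  obtain v t where C: "canonical_family k v t"
    using ex_canonical_family[of k] n by auto
  have aV: "a (v i) (v j) = (if i = j then 1 else 0)" if "i < 2 * k" "j < 2 * k" for i j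
    using C that unfolding canonical_family_def by simp
  have bV: "b (v i) (v j) = 0" if "i < 2 * k" "j < 2 * k" "i div 2 \<noteq> j div 2" for i j
    using C that unfolding canonical_family_def by simp
  have tV: "0 \<le> t l \<and> b (v (2 * l)) (v (2 * l + 1)) = of_real (t l)" if "l < k" for l
    using C that unfolding canonical_family_def by simp
  \<comment> \<open>For even \<open>n\<close> this is vacuous; for odd \<open>n\<close> one further
    unit vector completes the \<open>k\<close> pairs.\<close>
  have "\<exists>z. e = 1 \<longrightarrow> a z z = 1 \<and> (\<forall>i<2 * k. a (v i) z = 0 \<and> b (v i) z = 0)"
  proof (cases "e = 1")
    case True
    have "card (v ` {..<2 * k}) < n"
      using card_image_le[of "{..<2 * k}" v] n True by simp
    then obtain z where z: "z \<in> orth (v ` {..<2 * k})" "a z z = 1"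
      using ex_unit_orth[of "v ` {..<2 * k}"] by auto
    have "\<forall>i<2 * k. b (v i) z = 0"
      using C z(1) unfolding canonical_family_def by simp
    moreover have "\<forall>i<2 * k. a (v i) z = 0" using z(1) by (simp add: orth_def)
    ultimately show ?thesis using z(2) by blast
  qed simp
  then obtain z where z: "e = 1 \<Longrightarrow> a z z = 1"
    "\<And>i. e = 1 \<Longrightarrow> i < 2 * k \<Longrightarrow> a (v i) z = 0" "\<And>i. e = 1 \<Longrightarrow> i < 2 * k \<Longrightarrow> b (v i) z = 0"
    by auto
  have z': "a z (v i) = 0" "b z (v i) = 0" if "e = 1" "i < 2 * k" for i
    using z(2,3)[OF that] a_commute[of z "v i"] b_commute[of z "v i"] by simp_all
  \<comment> \<open>The extra vector comes first, matching the leading 1 x 1 block, and shifts the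
    others by \<open>e\<close>. Pairs are counted from 0 but blocks from 1, hence
    \<open>l - 1\<close> in \<open>s\<close>.\<close>
  define u where "u i = (if i < e then z else v (i - e))" for i
  define s where "s l = t (l - 1)" for l
  have u_old: "u i = v (i - e)" "i - e < 2 * k" "blk n i = (i - e) div 2 + 1" if "e \<le> i" "i < n" for i
  proof -
    show "u i = v (i - e)" using that(1) by (simp add: u_def)
    show "i - e < 2 * k" using that n by linarith
    show "blk n i = (i - e) div 2 + 1" using blk_shift[of n i] that(1) unfolding e_def by simp
  qed
  have u_new: "u i = z" "e = 1" "i = 0" if "\<not> e \<le> i" for i
    using that e by (simp_all add: u_def)
  have blk_new: "blk n i = 0" if "\<not> e \<le> i" for i
    using u_new(2,3)[OF that] by (simp add: blk_def e_def)
  show thesis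
  proof (rule that[of u s])
    fix i j assume ij: "i < n" "j < n"
    show "a (u i) (u j) = (if i = j then 1 else 0)"
    proof (cases "e \<le> i"; cases "e \<le> j")
      assume "e \<le> i" "e \<le> j"
      then show ?thesis using ij aV u_old by (simp add: eq_diff_iff)
    next
      assume "e \<le> i" "\<not> e \<le> j"
      then show ?thesis using ij u_old[of i] u_new[of j] z(2) by simp
    next
      assume "\<not> e \<le> i" "e \<le> j"
      then show ?thesis using ij u_old[of j] u_new[of i] z' by simp
    next
      assume "\<not> e \<le> i" "\<not> e \<le> j"
      then show ?thesis using u_new[of j] u_new[of i] z(1) by simp
    qed
    show "b (u i) (u j) = of_real (skew_entry n s i j)"
    proof (cases "e \<le> i"; cases "e \<le> j")
      assume e_le: "e \<le> i" "e \<le> j"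
      note U = u_old[OF e_le(1) ij(1)] u_old[OF e_le(2) ij(2)]
      define p q where "p = i - e" and "q = j - e"
      have pq: "p < 2 * k" "q < 2 * k" "i = p + e" "j = q + e"
        using U e_le by (simp_all add: p_def q_def)
      consider "p div 2 \<noteq> q div 2" | "p = q" | "p div 2 = q div 2" "p < q" | "p div 2 = q div 2" "q < p"
        by linarith
      then show ?thesis
      proof cases
        case 1
        then show ?thesis using U bV[OF pq(1,2)] by (simp add: skew_entry_def p_def q_def)
      next
        case 2
        then have "i = j" using pq(3,4) by simp
        then show ?thesis by (simp add: skew_entry_def)
      next
        case 3
        define l where "l = p div 2"
        have l: "p = 2 * l" "q = 2 * l + 1" "l < k" 
          using 3 pq(1) mult_div_mod_eq[of 2 p] mult_div_mod_eq[of 2 q]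
            mod_less_divisor[of 2 p] mod_less_divisor[of 2 q] unfolding l_def by linarith+
        have "b (v p) (v q) = of_real (t l)" using tV[OF l(3)] l(1,2) by simp
        then show ?thesis using U 3 pq(3,4) by (simp add: skew_entry_def s_def l_def flip: p_def q_def)
      next
        case 4
        define l where "l = q div 2"
        have l: "q = 2 * l" "p = 2 * l + 1" "l < k" 
          using 4 pq(2) mult_div_mod_eq[of 2 p] mult_div_mod_eq[of 2 q]
            mod_less_divisor[of 2 p] mod_less_divisor[of 2 q] unfolding l_def by linarith+
        have "b (v p) (v q) = - of_real (t l)" using tV[OF l(3)] l(1,2) b_commute[of "v p" "v q"] by simp
        then show ?thesis using U 4 pq(3,4) by (simp add: skew_entry_def s_def l_def flip: p_def q_def)
      qed
    next
      assume "e \<le> i" "\<not> e \<le> j"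
      then show ?thesis using ij u_old[of i] u_new[of j] z(3) blk_new by (simp add: skew_entry_def)
    next
      assume "\<not> e \<le> i" "e \<le> j"
      then show ?thesis using ij u_old[of j] u_new[of i] z' blk_new by (simp add: skew_entry_def)
    next
      assume "\<not> e \<le> i" "\<not> e \<le> j"
      then show ?thesis using u_new[of j] u_new[of i] by (simp add: skew_entry_def)
    qed
  next
    fix l assume "l \<in> {1..n div 2}"
    then show "0 \<le> s l" using tV[of "l - 1"] by (auto simp: s_def k_def)
  qed
qed

end

section \<open>Quaternionic matrices\<close>

lemma quat_mult_sel [simp]:
  "qRe (x * y) = qRe x * qRe y - qI x * qI y - qJ x * qJ y - qK x * qK y"
  "qI (x * y) = qRe x * qI y + qI x * qRe y + qJ x * qK y - qK x * qJ y"
  "qJ (x * y) = qRe x * qJ y - qI x * qK y + qJ x * qRe y + qK x * qI y"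
  "qK (x * y) = qRe x * qK y + qI x * qJ y - qJ x * qI y + qK x * qRe y"
  by (simp_all add: times_quat_def)

lemma quat_linear_sel [simp]:
  "qRe (x + y) = qRe x + qRe y" "qI (x + y) = qI x + qI y"
  "qJ (x + y) = qJ x + qJ y" "qK (x + y) = qK x + qK y"
  "qRe (x - y) = qRe x - qRe y" "qI (x - y) = qI x - qI y"
  "qJ (x - y) = qJ x - qJ y" "qK (x - y) = qK x - qK y"
  "qRe (- x) = - qRe x" "qI (- x) = - qI x" "qJ (- x) = - qJ x" "qK (- x) = - qK x"
  "qRe 0 = 0" "qI 0 = 0" "qJ 0 = 0" "qK 0 = 0"
  "qRe 1 = 1" "qI 1 = 0" "qJ 1 = 0" "qK 1 = 0"
  "qRe (of_real r) = r" "qI (of_real r) = 0" "qJ (of_real r) = 0" "qK (of_real r) = 0"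
  by (simp_all add: quat_arith_defs of_real_def)

lemma quat_cnj_sel [simp]:
  "qRe (quat_cnj x) = qRe x" "qI (quat_cnj x) = - qI x"
  "qJ (quat_cnj x) = - qJ x" "qK (quat_cnj x) = - qK x"
  by (simp_all add: quat_cnj_def)

lemma quat_of_complex_sel [simp]:
  "qRe (quat_of_complex z) = Re z" "qI (quat_of_complex z) = Im z"
  "qJ (quat_of_complex z) = 0" "qK (quat_of_complex z) = 0"
  by (simp_all add: quat_of_complex_def)

interpretation qc: inj_semiring_hom quat_of_complex
  by unfold_locales (auto simp: quat_eq_iff complex_eq_iff)

lemma quat_of_complex_of_real [simp]: "quat_of_complex (of_real r) = of_real r"
  by (simp add: quat_eq_iff)

lemma quat_of_complex_cnj: "quat_of_complex (cnj z) = quat_cnj (quat_of_complex z)"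
  by (simp add: quat_eq_iff)

lemma quat_cnj_mult: "quat_cnj (x * y) = quat_cnj y * quat_cnj x"
  by (simp add: quat_eq_iff)

lemma quat_cnj_add: "quat_cnj (x + y) = quat_cnj x + quat_cnj y"
  by (simp add: quat_eq_iff)

lemma quat_cnj_cnj [simp]: "quat_cnj (quat_cnj x) = x"
  by (simp add: quat_eq_iff)

lemma quat_cnj_0 [simp]: "quat_cnj 0 = 0" and quat_cnj_1 [simp]: "quat_cnj 1 = 1"
  by (simp_all add: quat_eq_iff)

lemma quat_cnj_sum: "quat_cnj (sum f S) = (\<Sum>x\<in>S. quat_cnj (f x))"
  by (induction S rule: infinite_finite_induct) (auto simp: quat_cnj_add)

definition quat_norm2 :: "quat \<Rightarrow> real" where
  "quat_norm2 q = (qRe q)\<^sup>2 + (qI q)\<^sup>2 + (qJ q)\<^sup>2 + (qK q)\<^sup>2"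

lemma quat_cnj_mult_self: "quat_cnj q * q = of_real (quat_norm2 q)"
  by (simp add: quat_eq_iff quat_norm2_def power2_eq_square)

lemma quat_norm2_pos:
  assumes "q \<noteq> 0"
  shows "0 < quat_norm2 q"
proof (rule ccontr)
  assume "\<not> 0 < quat_norm2 q"
  then have "(qRe q)\<^sup>2 = 0 \<and> (qI q)\<^sup>2 = 0 \<and> (qJ q)\<^sup>2 = 0 \<and> (qK q)\<^sup>2 = 0"
    unfolding quat_norm2_def
    using zero_le_power2[of "qRe q"] zero_le_power2[of "qI q"] zero_le_power2[of "qJ q"]
      zero_le_power2[of "qK q"] by linarith
  then show False using assms by (simp add: quat_eq_iff)
qed

lemma quat_norm2_nonneg: "0 \<le> quat_norm2 q"
  by (simp add: quat_norm2_def)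

section \<open>Splitting a quaternion into two complex components\<close>

definition complex_part :: "quat \<Rightarrow> complex" where
  "complex_part q = Complex (qRe q) (qI q)"

lemma complex_part_sel [simp]: "Re (complex_part q) = qRe q" "Im (complex_part q) = qI q"
  by (simp_all add: complex_part_def)

lemma complex_part_0 [simp]: "complex_part 0 = 0"
  by (simp add: complex_eq_iff)

lemma complex_part_add: "complex_part (x + y) = complex_part x + complex_part y"
  by (simp add: complex_eq_iff)

lemma complex_part_sum: "complex_part (sum f S) = (\<Sum>x\<in>S. complex_part (f x))"
  by (induction S rule: infinite_finite_induct) (auto simp: complex_part_add)

lemma complex_part_of_real [simp]: "complex_part (of_real r) = of_real r"
  by (simp add: complex_eq_iff)

lemma complex_part_mult_complex:
  "complex_part (quat_of_complex z * q) = z * complex_part q"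
  "complex_part (q * quat_of_complex z) = complex_part q * z"
  by (simp_all add: complex_eq_iff)

lemma complex_part_cnj: "complex_part (quat_cnj q) = cnj (complex_part q)"
  by (simp add: complex_eq_iff)

lemma of_real_mult_commute_quat: "of_real r * q = q * (of_real r :: quat)"
  by (simp add: quat_eq_iff)

text \<open>Writing \<open>q = \<alpha> + \<beta> * \<eta>\<close> with \<open>\<alpha>\<close>, \<open>\<beta>\<close> complex, \<open>\<beta>\<close> is the second part of \<open>q\<close>.\<close>

definition second_part :: "quat \<Rightarrow> quat \<Rightarrow> complex" where
  "second_part \<eta> q = - complex_part (q * \<eta>)"

context
  fixes \<eta> :: quat
  assumes eta: "\<eta> \<in> {quat_j, quat_k}"
begin

text \<open>\<eta> anticommutes with i.\<close>

lemma complex_mult_eta: "quat_of_complex z * \<eta> = \<eta> * quat_of_complex (cnj z)"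
  using eta by (auto simp: quat_eq_iff quat_j_def quat_k_def)

lemma complex_part_eta_real: "complex_part (\<eta> * of_real r) = 0"
  using eta by (auto simp: complex_eq_iff quat_j_def quat_k_def)

lemma quat_parts: "quat_of_complex (complex_part q) + quat_of_complex (second_part \<eta> q) * \<eta> = q"
  using eta by (auto simp: quat_eq_iff second_part_def quat_j_def quat_k_def)

text \<open>The conjugate of \<beta> * \<eta> is - \<eta> times the conjugate of \<beta>, that is, -
  \<beta> * \<eta>. For a self-adjoint matrix this makes the second parts skew-symmetric.\<close>

lemma second_part_cnj: "second_part \<eta> (quat_cnj q) = - second_part \<eta> q"
  using eta by (auto simp: complex_eq_iff second_part_def quat_j_def quat_k_def)

text \<open>A complex factor on the right has to pass \<eta> and is conjugated on the way.\<close>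

lemma second_part_mult_complex:
  "second_part \<eta> (quat_of_complex z * q) = z * second_part \<eta> q"
  "second_part \<eta> (q * quat_of_complex z) = second_part \<eta> q * cnj z"
  by (simp_all add: second_part_def mult.assoc complex_mult_eta complex_part_mult_complex(1))
    (simp add: complex_part_mult_complex(2) flip: mult.assoc)

lemma second_part_sum: "second_part \<eta> (sum f S) = (\<Sum>x\<in>S. second_part \<eta> (f x))"
  by (simp add: second_part_def sum_distrib_right complex_part_sum sum_negf)

end

section \<open>Adjoints, inverses and entries of matrix products\<close>

lemma qmat_adjoint_carrier [simp]: "A \<in> carrier_mat nr nc \<Longrightarrow> qmat_adjoint A \<in> carrier_mat nc nr"
  by (auto simp: qmat_adjoint_def)

lemma qmat_adjoint_dim [simp]: "dim_row (qmat_adjoint A) = dim_col A" "dim_col (qmat_adjoint A) = dim_row A"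
  by (simp_all add: qmat_adjoint_def)

lemma qmat_adjoint_index [simp]:
  "i < dim_col A \<Longrightarrow> j < dim_row A \<Longrightarrow> qmat_adjoint A $$ (i, j) = quat_cnj (A $$ (j, i))"
  by (simp add: qmat_adjoint_def)

lemma qmat_adjoint_mult:
  assumes "A \<in> carrier_mat nr n" "B \<in> carrier_mat n nc"
  shows "qmat_adjoint (A * B) = qmat_adjoint B * qmat_adjoint A"
  using assms by (intro eq_matI) (auto simp: scalar_prod_def quat_cnj_sum quat_cnj_mult)

lemma qmat_adjoint_one [simp]: "qmat_adjoint (1\<^sub>m n) = 1\<^sub>m n"
  by (intro eq_matI) auto

lemma invertible_mat_inverse:
  assumes "G \<in> carrier_mat n n" "invertible_mat G"
  obtains F where "F \<in> carrier_mat n n" "G * F = 1\<^sub>m n" "F * G = 1\<^sub>m n"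
proof -
  obtain F where F: "G * F = 1\<^sub>m n" "F * G = 1\<^sub>m (dim_row F)"
    using assms unfolding invertible_mat_def inverts_mat_def by auto
  have "dim_col F = n" using arg_cong[OF F(1), of dim_col] by simp
  moreover have "dim_row F = n" using arg_cong[OF F(2), of dim_col] assms(1) by simp
  ultimately show thesis using that F by (metis carrier_matI)
qed

lemma mat_mult_index:
  fixes A B :: "'a::semiring_0 mat"
  assumes "A \<in> carrier_mat nr n" "B \<in> carrier_mat n nc" "i < nr" "j < nc"
  shows "(A * B) $$ (i, j) = (\<Sum>p<n. A $$ (i, p) * B $$ (p, j))"
  using assms by (auto simp: scalar_prod_def lessThan_atLeast0 intro!: sum.cong)

lemma mat_triple_index:
  fixes A B C :: "'a::semiring_1 mat"
  assumes "A \<in> carrier_mat nr n" "B \<in> carrier_mat n k" "C \<in> carrier_mat k nc" "i < nr" "j < nc"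
  shows "(A * B * C) $$ (i, j) = (\<Sum>p<n. \<Sum>q<k. A $$ (i, p) * B $$ (p, q) * C $$ (q, j))"
proof -
  have "(A * B * C) $$ (i, j) = (\<Sum>q<k. (\<Sum>p<n. A $$ (i, p) * B $$ (p, q)) * C $$ (q, j))"
    using assms mat_mult_index[of "A * B" nr k C nc i j] mat_mult_index[OF assms(1,2,4)] by simp
  also have "\<dots> = (\<Sum>q<k. \<Sum>p<n. A $$ (i, p) * B $$ (p, q) * C $$ (q, j))"
    by (simp add: sum_distrib_right)
  also have "\<dots> = (\<Sum>p<n. \<Sum>q<k. A $$ (i, p) * B $$ (p, q) * C $$ (q, j))"
    by (rule sum.swap)
  finally show ?thesis .
qed

section \<open>Products and adjoints of block diagonal matrices\<close>

lemma diag_block_mat_carrier: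
  "(\<And>l. l \<in> set ls \<Longrightarrow> f l \<in> carrier_mat (d l) (d l)) \<Longrightarrow>
    diag_block_mat (map f ls) \<in> carrier_mat (sum_list (map d ls)) (sum_list (map d ls))"
  by (induction ls) (auto simp: Let_def)

text \<open>One index list with a common size function \<open>d\<close> makes the blocks of the
  factors match, so that induction reduces the claim to multiplying 2 x 2 block matrices.\<close>

lemma diag_block_mat_mult:
  fixes f g :: "'b \<Rightarrow> 'a::semiring_1 mat"
  assumes "\<And>l. l \<in> set ls \<Longrightarrow> f l \<in> carrier_mat (d l) (d l)"
    and "\<And>l. l \<in> set ls \<Longrightarrow> g l \<in> carrier_mat (d l) (d l)"
  shows "diag_block_mat (map f ls) * diag_block_mat (map g ls) = diag_block_mat (map (\<lambda>l. f l * g l) ls)"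
  using assms
proof (induction ls)
  case (Cons l ls)
  let ?N = "sum_list (map d ls)"
  have c: "f l \<in> carrier_mat (d l) (d l)" "g l \<in> carrier_mat (d l) (d l)"
    "diag_block_mat (map f ls) \<in> carrier_mat ?N ?N" "diag_block_mat (map g ls) \<in> carrier_mat ?N ?N"
    using Cons.prems by (auto intro!: diag_block_mat_carrier)
  then have "diag_block_mat (map f (l # ls)) * diag_block_mat (map g (l # ls)) =
    four_block_mat (f l) (0\<^sub>m (d l) ?N) (0\<^sub>m ?N (d l)) (diag_block_mat (map f ls)) *
    four_block_mat (g l) (0\<^sub>m (d l) ?N) (0\<^sub>m ?N (d l)) (diag_block_mat (map g ls))"
    by (auto simp: Let_def)
  also have "\<dots> = four_block_mat (f l * g l) (0\<^sub>m (d l) ?N) (0\<^sub>m ?N (d l))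
    (diag_block_mat (map f ls) * diag_block_mat (map g ls))"
    using c by (subst mult_four_block_mat) auto
  also have "diag_block_mat (map f ls) * diag_block_mat (map g ls) = diag_block_mat (map (\<lambda>l. f l * g l) ls)"
    using Cons by auto
  moreover have "f l * g l \<in> carrier_mat (d l) (d l)" if "l \<in> set ls" for l
    using Cons.prems that by (intro mult_carrier_mat[of _ "d l" "d l"]) auto
  then have "diag_block_mat (map (\<lambda>l. f l * g l) ls) \<in> carrier_mat ?N ?N"
    by (rule diag_block_mat_carrier)
  ultimately show ?case using c by (auto simp: Let_def)
qed simp

lemma diag_block_mat_adjoint:
  assumes "\<And>l. l \<in> set ls \<Longrightarrow> f l \<in> carrier_mat (d l) (d l)"
  shows "qmat_adjoint (diag_block_mat (map f ls)) = diag_block_mat (map (\<lambda>l. qmat_adjoint (f l)) ls)"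
  using assms
proof (induction ls)
  case Nil
  show ?case by (intro eq_matI) auto
next
  case (Cons l ls)
  let ?N = "sum_list (map d ls)"
  have c: "f l \<in> carrier_mat (d l) (d l)" "diag_block_mat (map f ls) \<in> carrier_mat ?N ?N"
    using Cons.prems by (auto intro!: diag_block_mat_carrier)
  then have "qmat_adjoint (diag_block_mat (map f (l # ls))) =
    qmat_adjoint (four_block_mat (f l) (0\<^sub>m (d l) ?N) (0\<^sub>m ?N (d l)) (diag_block_mat (map f ls)))"
    by (auto simp: Let_def)
  also have "\<dots> = four_block_mat (qmat_adjoint (f l)) (0\<^sub>m (d l) ?N) (0\<^sub>m ?N (d l))
    (qmat_adjoint (diag_block_mat (map f ls)))"
    using c by (intro eq_matI) auto
  also have "qmat_adjoint (diag_block_mat (map f ls)) = diag_block_mat (map (\<lambda>l. qmat_adjoint (f l)) ls)"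
    using Cons by auto
  moreover have "diag_block_mat (map (\<lambda>l. qmat_adjoint (f l)) ls) \<in> carrier_mat ?N ?N"
    using Cons.prems by (intro diag_block_mat_carrier) auto
  ultimately show ?case using c by (auto simp: Let_def)
qed

section \<open>The matrices \<open>B_mat\<close> as a one-parameter family\<close>

lemma B_block_carrier [simp]: "B_block \<eta> t \<in> carrier_mat 2 2"
  by (simp add: B_block_def mat_of_rows_list_def numeral_2_eq_2)

lemma B_block_dim [simp]: "dim_row (B_block \<eta> t) = 2" "dim_col (B_block \<eta> t) = 2"
  by (rule carrier_matD[OF B_block_carrier])+

lemma B_block_index:
  "i < 2 \<Longrightarrow> j < 2 \<Longrightarrow> B_block \<eta> t $$ (i, j) =
    (if i = j then of_real (cosh t) else if i < j then \<eta> * of_real (sinh t) else - \<eta> * of_real (sinh t))"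
  by (auto simp: B_block_def mat_of_rows_list_def less_2_cases_iff)

text \<open>The \<open>0\<close>-th block is the leading \<open>1 \<times> 1\<close> identity of the odd-dimensional case.\<close>

definition B_part :: "quat \<Rightarrow> (nat \<Rightarrow> real) \<Rightarrow> nat \<Rightarrow> quat mat" where
  "B_part \<eta> \<theta> l = (if l = 0 then 1\<^sub>m 1 else B_block \<eta> (\<theta> l))"

definition part_indices :: "nat \<Rightarrow> nat list" where
  "part_indices n = (if even n then [] else [0]) @ [1..<Suc (n div 2)]"

lemma B_mat_eq: "B_mat \<eta> n \<theta> = diag_block_mat (map (B_part \<eta> \<theta>) (part_indices n))"
proof -
  have *: "map (B_part \<eta> \<theta>) [1..<Suc (n div 2)] = map (\<lambda>l. B_block \<eta> (\<theta> l)) [1..<Suc (n div 2)]"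
    by (rule map_cong) (auto simp: B_part_def)
  show ?thesis
    unfolding B_mat_def part_indices_def map_append * by (simp add: B_part_def del: upt_Suc)
qed

abbreviation part_dim :: "nat \<Rightarrow> nat" where
  "part_dim l \<equiv> (if l = 0 then 1 else 2)"

lemma B_part_carrier: "B_part \<eta> \<theta> l \<in> carrier_mat (part_dim l) (part_dim l)"
  by (simp add: B_part_def)

lemma sum_part_dim: "sum_list (map part_dim (part_indices n)) = n"
proof -
  have "sum_list (map part_dim [1..<Suc k]) = 2 * k" for k
    by (induction k) auto
  then show ?thesis
    by (simp add: part_indices_def del: upt_Suc)
qed

lemma B_mat_carrier [simp]: "B_mat \<eta> n \<theta> \<in> carrier_mat n n"
  using diag_block_mat_carrier[of "part_indices n" "B_part \<eta> \<theta>" part_dim, OF B_part_carrier]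
  unfolding B_mat_eq sum_part_dim .

text \<open>Together with the addition law for the parameters, this shows that negating the
  parameters inverts \<open>B_mat\<close>.\<close>

lemma B_mat_zero: "B_mat \<eta> n (\<lambda>_. 0) = 1\<^sub>m n"
proof -
  have "B_part \<eta> (\<lambda>_. 0) = (\<lambda>l. 1\<^sub>m (part_dim l))"
    unfolding B_part_def by (intro ext eq_matI) (auto simp: B_block_index)
  moreover have "diag_block_mat (map (\<lambda>l. 1\<^sub>m (d l)) ls) = (1\<^sub>m (sum_list (map d ls)) :: quat mat)" for d and ls :: "nat list"
    by (induction ls) (auto simp: Let_def)
  ultimately show ?thesis unfolding B_mat_eq by (simp add: sum_part_dim)
qed

context
  fixes \<eta> :: quat
  assumes eta: "\<eta> \<in> {quat_j, quat_k}"
begin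

text \<open>Since \<eta> squares to -1, the product of two blocks reproduces the addition formulas
  of cosh and sinh.\<close>

lemma B_mat_mult: "B_mat \<eta> n \<theta> * B_mat \<eta> n \<phi> = B_mat \<eta> n (\<lambda>l. \<theta> l + \<phi> l)"
proof -
  have "B_block \<eta> s * B_block \<eta> t = B_block \<eta> (s + t)" for s t
  proof (rule eq_matI)
    fix i j assume "i < dim_row (B_block \<eta> (s + t))" "j < dim_col (B_block \<eta> (s + t))"
    then have ij: "i < 2" "j < 2" by simp_all
    have "(B_block \<eta> s * B_block \<eta> t) $$ (i, j) =
      B_block \<eta> s $$ (i, 0) * B_block \<eta> t $$ (0, j) + B_block \<eta> s $$ (i, 1) * B_block \<eta> t $$ (1, j)"
      using ij mat_mult_index[of "B_block \<eta> s" 2 2 "B_block \<eta> t" 2 i j]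
      by (simp add: numeral_2_eq_2[THEN arg_cong[of _ _ lessThan]] lessThan_Suc)
    also have "\<dots> = B_block \<eta> (s + t) $$ (i, j)"
      using ij eta unfolding less_2_cases_iff
      by (auto simp: B_block_index quat_eq_iff quat_j_def quat_k_def cosh_add sinh_add)
    finally show "(B_block \<eta> s * B_block \<eta> t) $$ (i, j) = B_block \<eta> (s + t) $$ (i, j)" .
  qed simp_all
  then have "B_part \<eta> \<theta> l * B_part \<eta> \<phi> l = B_part \<eta> (\<lambda>l. \<theta> l + \<phi> l) l" for l
    by (simp add: B_part_def)
  then show ?thesis
    unfolding B_mat_eq by (subst diag_block_mat_mult[where d = part_dim]) (auto simp: B_part_carrier[simplified])
qed

text \<open>The off-diagonal entries of a block are opposite real multiples of \<eta>, and
  conjugation changes their sign.\<close>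

lemma B_mat_adjoint: "qmat_adjoint (B_mat \<eta> n \<theta>) = B_mat \<eta> n \<theta>"
proof -
  have "qmat_adjoint (B_block \<eta> t) = B_block \<eta> t" for t
  proof (rule eq_matI)
    fix i j assume "i < dim_row (B_block \<eta> t)" "j < dim_col (B_block \<eta> t)"
    then show "qmat_adjoint (B_block \<eta> t) $$ (i, j) = B_block \<eta> t $$ (i, j)"
      using eta by (auto simp: B_block_index quat_eq_iff quat_j_def quat_k_def)
  qed simp_all
  then have "qmat_adjoint (B_part \<eta> \<theta> l) = B_part \<eta> \<theta> l" for l
    by (simp add: B_part_def)
  then show ?thesis
    unfolding B_mat_eq by (subst diag_block_mat_adjoint[where d = part_dim]) (auto simp: B_part_carrier[simplified])
qed

end

lemma diag_B_block_index:
  "i < 2 * length ls \<Longrightarrow> j < 2 * length ls \<Longrightarrow>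
    diag_block_mat (map (\<lambda>l. B_block \<eta> (\<theta> l)) ls) $$ (i, j) =
    (if i div 2 = j div 2 then B_block \<eta> (\<theta> (ls ! (i div 2))) $$ (i mod 2, j mod 2) else 0)"
proof (induction ls arbitrary: i j)
  case (Cons l ls)
  let ?D = "diag_block_mat (map (\<lambda>l. B_block \<eta> (\<theta> l)) ls)"
  have D: "?D \<in> carrier_mat (2 * length ls) (2 * length ls)"
    using diag_block_mat_carrier[of ls "\<lambda>l. B_block \<eta> (\<theta> l)" "\<lambda>_. 2"] by (simp add: sum_list_triv mult.commute)
  have idx: "diag_block_mat (map (\<lambda>l. B_block \<eta> (\<theta> l)) (l # ls)) $$ (i, j) =
    (if i < 2 then if j < 2 then B_block \<eta> (\<theta> l) $$ (i, j) else 0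
     else if j < 2 then 0 else ?D $$ (i - 2, j - 2))"
    using Cons.prems D by (simp add: Let_def)
  have big: "\<exists>i'. i = Suc (Suc i')" if "\<not> i < 2" for i :: nat
    using that by presburger
  show ?case
  proof (cases "i < 2"; cases "j < 2")
    assume "i < 2" "j < 2"
    then show ?thesis unfolding idx by simp
  next
    assume ij: "i < 2" "\<not> j < 2"
    then obtain j' where "j = Suc (Suc j')" using big by blast
    then show ?thesis unfolding idx using ij by simp
  next
    assume ij: "\<not> i < 2" "j < 2"
    then obtain i' where "i = Suc (Suc i')" using big by blast
    then show ?thesis unfolding idx using ij by simp
  next
    assume ij: "\<not> i < 2" "\<not> j < 2"
    then obtain i' j' where *: "i = Suc (Suc i')" "j = Suc (Suc j')" using big by blast
    have "?D $$ (i', j') = (if i' div 2 = j' div 2 then B_block \<eta> (\<theta> (ls ! (i' div 2))) $$ (i' mod 2, j' mod 2) else 0)"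
      by (rule Cons.IH) (use Cons.prems * in auto)
    then show ?thesis unfolding idx using * by simp
  qed
qed simp

text \<open>The value 1 for block 0 is the leading diagonal entry in odd dimension.\<close>

definition cosh_entry :: "nat \<Rightarrow> (nat \<Rightarrow> real) \<Rightarrow> nat \<Rightarrow> real" where
  "cosh_entry n \<theta> i = (if blk n i = 0 then 1 else cosh (\<theta> (blk n i)))"

text \<open>A real diagonal matrix plus \<eta> times a real skew-symmetric one; from this form the
  complex part and the effect of conjugation by i can be read off. In odd dimension the leading
  block shifts the indices by one.\<close>

lemma B_mat_index:
  assumes "i < n" "j < n"
  shows "B_mat \<eta> n \<theta> $$ (i, j) =
    (if i = j then of_real (cosh_entry n \<theta> i)
     else \<eta> * of_real (skew_entry n (\<lambda>l. sinh (\<theta> l)) i j))"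
proof -
  let ?ls = "[1..<Suc (n div 2)]"
  let ?D = "diag_block_mat (map (\<lambda>l. B_block \<eta> (\<theta> l)) ?ls)"
  have core: "?D $$ (p, q) = (if p = q then of_real (cosh (\<theta> (p div 2 + 1)))
      else if p div 2 \<noteq> q div 2 then 0
      else if p < q then \<eta> * of_real (sinh (\<theta> (p div 2 + 1)))
      else - \<eta> * of_real (sinh (\<theta> (p div 2 + 1))))"
    if pq: "p < 2 * (n div 2)" "q < 2 * (n div 2)" for p q
  proof -
    have nth: "?ls ! (p div 2) = p div 2 + 1" using pq(1) by (subst nth_upt) auto
    have "?D $$ (p, q) =
      (if p div 2 = q div 2 then B_block \<eta> (\<theta> (?ls ! (p div 2))) $$ (p mod 2, q mod 2) else 0)"
      by (rule diag_B_block_index) (use pq in auto)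
    moreover have eq: "p mod 2 = q mod 2 \<longleftrightarrow> p = q" if "p div 2 = q div 2"
      using that by (metis mult_div_mod_eq)
    moreover have less: "p mod 2 < q mod 2 \<longleftrightarrow> p < q" if "p div 2 = q div 2"
      using that mult_div_mod_eq[of 2 p] mult_div_mod_eq[of 2 q]
      by (metis nat_add_left_cancel_less)
    moreover have "p mod 2 < 2" "q mod 2 < 2" by simp_all
    ultimately show ?thesis unfolding nth by (cases "p div 2 = q div 2") (auto simp only: B_block_index if_True if_False split: if_splits)
  qed
  show ?thesis
  proof (cases "even n")
    case True
    then have "blk n p = p div 2 + 1" for p by (simp add: blk_def even_iff_mod_2_eq_zero)
    moreover have "B_mat \<eta> n \<theta> = ?D" using True by (simp add: B_mat_def del: upt_Suc)
    moreover have "2 * (n div 2) = n" using True by simp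
    ultimately show ?thesis using core[of i j] assms by (auto simp: skew_entry_def cosh_entry_def)
  next
    case False
    then have blk: "blk n p = (p + 1) div 2" for p by (simp add: blk_def odd_iff_mod_2_eq_one)
    have n: "n = Suc (2 * (n div 2))" using False by presburger
    have D: "?D \<in> carrier_mat (2 * (n div 2)) (2 * (n div 2))"
      using diag_block_mat_carrier[of ?ls "\<lambda>l. B_block \<eta> (\<theta> l)" "\<lambda>_. 2"]
      by (simp add: sum_list_triv mult.commute del: upt_Suc)
    have "B_mat \<eta> n \<theta> = four_block_mat (1\<^sub>m 1) (0\<^sub>m 1 (2 * (n div 2))) (0\<^sub>m (2 * (n div 2)) 1) ?D"
      using False D by (simp add: B_mat_def Let_def del: upt_Suc)
    then have idx: "B_mat \<eta> n \<theta> $$ (i, j) = (if i = 0 then if j = 0 then 1 else 0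
      else if j = 0 then 0 else ?D $$ (i - 1, j - 1))"
      using D assms n by (simp del: upt_Suc)
    consider "i = 0 \<or> j = 0" | p q where "i = Suc p" "j = Suc q"
      by (meson not0_implies_Suc)
    then show ?thesis
    proof cases
      case 1
      then show ?thesis unfolding idx by (auto simp: skew_entry_def cosh_entry_def blk)
    next
      case 2
      have "p < 2 * (n div 2)" "q < 2 * (n div 2)" using 2 assms n by linarith+
      then show ?thesis
        unfolding idx using core[of p q] 2 by (auto simp: skew_entry_def cosh_entry_def blk)
    qed
  qed
qed

section \<open>Uniqueness\<close>

text \<open>The inverse of \<open>quat_i\<close> is \<open>- quat_i\<close>, so this is the inner
  automorphism given by i. It fixes the complex numbers and negates j and k.\<close>

definition i_conj :: "quat \<Rightarrow> quat" where
  "i_conj q = quat_i * q * (- quat_i)"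

interpretation i_conj: semiring_hom i_conj
  by unfold_locales (auto simp: i_conj_def quat_i_def quat_eq_iff)

lemma i_conj_complex [simp]: "i_conj (quat_of_complex z) = quat_of_complex z"
  by (simp add: i_conj_def quat_i_def quat_eq_iff)

lemma i_conj_of_real [simp]: "i_conj (of_real r) = of_real r"
  by (simp add: i_conj_def quat_i_def quat_eq_iff)

lemma i_conj_eta: "\<eta> \<in> {quat_j, quat_k} \<Longrightarrow> i_conj (\<eta> * of_real r) = \<eta> * of_real (- r)"
  by (auto simp: i_conj_def quat_i_def quat_j_def quat_k_def quat_eq_iff)

lemma map_i_conj_complex [simp]: "map_mat i_conj (map_mat quat_of_complex W) = map_mat quat_of_complex W"
  by (intro eq_matI) auto

text \<open>The sign picked up by \<eta> is absorbed into the parameters, as sinh is odd and cosh is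
  even.\<close>

lemma map_i_conj_B_mat:
  assumes "\<eta> \<in> {quat_j, quat_k}"
  shows "map_mat i_conj (B_mat \<eta> n \<theta>) = B_mat \<eta> n (\<lambda>l. - \<theta> l)"
proof (rule eq_matI)
  fix i j assume "i < dim_row (B_mat \<eta> n (\<lambda>l. - \<theta> l))" "j < dim_col (B_mat \<eta> n (\<lambda>l. - \<theta> l))"
  then have "i < n" "j < n" using carrier_matD[OF B_mat_carrier[of \<eta> n "\<lambda>l. - \<theta> l"]] by simp_all
  then show "map_mat i_conj (B_mat \<eta> n \<theta>) $$ (i, j) = B_mat \<eta> n (\<lambda>l. - \<theta> l) $$ (i, j)"
    using carrier_matD[OF B_mat_carrier[of \<eta> n \<theta>]] i_conj_eta[OF assms]
    by (simp add: B_mat_index skew_entry_def cosh_entry_def)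
qed (use carrier_matD[OF B_mat_carrier[of \<eta> n]] in simp_all)

text \<open>Adjoints of complex matrices are complex, hence also fixed by conjugation with
  i.\<close>

lemma adjoint_complex:
  "qmat_adjoint (map_mat quat_of_complex W) =
    map_mat quat_of_complex (mat (dim_col W) (dim_row W) (\<lambda>(i, j). cnj (W $$ (j, i))))"
  by (intro eq_matI) (auto simp: quat_of_complex_cnj)

lemma proots_prod_linear_factors: "proots (\<Prod>a\<leftarrow>xs. [:- a, 1::'a::idom:]) = mset xs"
proof (induction xs)
  case (Cons x xs)
  have "(\<Prod>a\<leftarrow>xs. [:- a, 1::'a:]) \<noteq> 0" by (auto simp: prod_list_zero_iff)
  then show ?case using Cons by (simp add: proots_mult del: mult_pCons_left)
qed simp

text \<open>The diagonal entries are the roots, with multiplicity, of the characteristic polynomial,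
  which similarity preserves.\<close>

lemma similar_upper_triangular_diag:
  fixes A B :: "'a::idom mat"
  assumes "A \<in> carrier_mat n n" "B \<in> carrier_mat n n" "upper_triangular A" "upper_triangular B"
    and "similar_mat A B"
  shows "mset (diag_mat A) = mset (diag_mat B)"
  using char_poly_similar[OF assms(5)] char_poly_upper_triangular[OF assms(1,3)]
    char_poly_upper_triangular[OF assms(2,4)] proots_prod_linear_factors by metis

text \<open>Counts the rows of each block, and so the multiplicity with which each cosh value occurs
  on the diagonal.\<close>

lemma mset_blk:
  "mset (map (blk n) [0..<n]) = (if even n then {#} else {#0#}) + repeat_mset 2 (mset_set {1..n div 2})"
proof -
  have *: "mset (map (\<lambda>i. i div 2 + 1) [0..<2 * k]) = repeat_mset 2 (mset_set {1..k})" for k :: nat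
  proof (induction k)
    case (Suc k)
    have "[0..<2 * Suc k] = [0..<2 * k] @ [2 * k, Suc (2 * k)]" by simp
    moreover have "{1..Suc k} = insert (Suc k) {1..k}" by auto
    moreover have "replicate_mset 2 x = {#x, x#}" for x :: nat by (simp add: numeral_2_eq_2)
    ultimately show ?case using Suc by simp
  qed simp
  show ?thesis
  proof (cases "even n")
    case True
    then have "blk n = (\<lambda>i. i div 2 + 1)" by (auto simp: blk_def)
    then show ?thesis using *[of "n div 2"] True by simp
  next
    case False
    then obtain k where n: "n = Suc (2 * k)" by (metis oddE Suc_eq_plus1)
    have upt: "[0..<n] = 0 # map Suc [0..<2 * k]"
      unfolding n by (simp add: map_Suc_upt upt_conv_Cons del: upt_Suc)
    have tail: "map (blk n) (map Suc [0..<2 * k]) = map (\<lambda>i. i div 2 + 1) [0..<2 * k]"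
      using False by (simp add: blk_def odd_iff_mod_2_eq_one)
    have "blk n 0 = 0" "n div 2 = k" using n by (simp_all add: blk_def odd_iff_mod_2_eq_one)
    then show ?thesis
      unfolding upt list.map(2) tail mset.simps *[of k] using False by simp
  qed
qed

lemma repeat_mset_cancel_pos: "0 < k \<Longrightarrow> repeat_mset k X = repeat_mset k Y \<Longrightarrow> X = Y"
  by (metis count_repeat_mset multiset_eqI mult_left_cancel neq0_conv)

context
  fixes \<eta> :: quat
  assumes eta: "\<eta> \<in> {quat_j, quat_k}"
begin

text \<open>The complex matrix \<open>W\<close> is fixed by conjugation with \<open>i\<close>, which inverts the middle factor;
  comparing the congruence with its conjugate turns it into a similarity.\<close>

lemma congruence_imp_similarity:
  assumes W: "W \<in> carrier_mat n n" and W': "W' \<in> carrier_mat n n" and inv: "W * W' = 1\<^sub>m n"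
    and cong: "qmat_adjoint (map_mat quat_of_complex W) * B_mat \<eta> n \<theta> * map_mat quat_of_complex W = B_mat \<eta> n \<phi>"
  shows "B_mat \<eta> n (\<lambda>l. 2 * \<theta> l) * map_mat quat_of_complex W =
    map_mat quat_of_complex W * B_mat \<eta> n (\<lambda>l. 2 * \<phi> l)"
proof -
  let ?C = "map_mat quat_of_complex" and ?B = "B_mat \<eta> n"
  let ?L = "qmat_adjoint (?C W)" and ?K = "qmat_adjoint (?C W')"
  have c: "?C W \<in> carrier_mat n n" "?C W' \<in> carrier_mat n n" "?L \<in> carrier_mat n n" "?K \<in> carrier_mat n n"
    using W W' by simp_all
  have Bc: "?B \<psi> \<in> carrier_mat n n" for \<psi> by simp
  have "map_mat i_conj ?L = ?L" unfolding adjoint_complex by simp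
  moreover have "map_mat i_conj (?L * ?B \<theta> * ?C W) =
    map_mat i_conj ?L * map_mat i_conj (?B \<theta>) * map_mat i_conj (?C W)"
    by (simp add: i_conj.mat_hom_mult[OF mult_carrier_mat[OF c(3) Bc] c(1)] i_conj.mat_hom_mult[OF c(3) Bc])
  ultimately have conj: "?L * ?B (\<lambda>l. - \<theta> l) * ?C W = ?B (\<lambda>l. - \<phi> l)"
    using cong map_i_conj_B_mat[OF eta] by simp
  have "W' * W = 1\<^sub>m n" using mat_mult_left_right_inverse[OF W W' inv] .
  then have "?C W * ?C W' = 1\<^sub>m n"
    using inv qc.mat_hom_mult[OF W W'] qc.mat_hom_one by simp
  then have KL: "?K * ?L = 1\<^sub>m n"
    using qmat_adjoint_mult[OF c(1,2)] by simp
  have "?L * (?B \<theta> * ?C W) = ?B \<phi>"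
    using cong by (simp add: assoc_mult_mat[OF c(3) Bc c(1)])
  \<comment> \<open>After this splitting the conjugated congruence can be inserted for the first
    factor. Both sides then begin with \<open>?L\<close>, which its left inverse \<open>?K\<close>
    cancels.\<close>
  also have "\<dots> = ?B (\<lambda>l. - \<phi> l) * ?B (\<lambda>l. 2 * \<phi> l)"
    by (simp add: B_mat_mult[OF eta])
  also have "\<dots> = ?L * (?B (\<lambda>l. - \<theta> l) * (?C W * ?B (\<lambda>l. 2 * \<phi> l)))"
    unfolding conj[symmetric]
    by (simp only: assoc_mult_mat[OF mult_carrier_mat[OF c(3) Bc] c(1) Bc]
        assoc_mult_mat[OF c(3) Bc mult_carrier_mat[OF c(1) Bc]])
  finally have eq: "?K * (?L * (?B \<theta> * ?C W)) = ?K * (?L * (?B (\<lambda>l. - \<theta> l) * (?C W * ?B (\<lambda>l. 2 * \<phi> l))))"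
    by simp
  have canc: "?K * (?L * X) = X" if "X \<in> carrier_mat n n" for X
    using assoc_mult_mat[OF c(4,3) that] KL that by simp
  from eq have "?B \<theta> * ?C W = ?B (\<lambda>l. - \<theta> l) * (?C W * ?B (\<lambda>l. 2 * \<phi> l))"
    by (simp only: canc[OF mult_carrier_mat[OF Bc c(1)]]
        canc[OF mult_carrier_mat[OF Bc mult_carrier_mat[OF c(1) Bc]]])
  \<comment> \<open>A further factor B(\<theta>) doubles the parameters on the left and cancels B(-
    \<theta>) on the right.\<close>
  then have "?B \<theta> * (?B \<theta> * ?C W) = ?B \<theta> * (?B (\<lambda>l. - \<theta> l) * (?C W * ?B (\<lambda>l. 2 * \<phi> l)))"
    by simp
  then have "(?B \<theta> * ?B \<theta>) * ?C W = (?B \<theta> * ?B (\<lambda>l. - \<theta> l)) * (?C W * ?B (\<lambda>l. 2 * \<phi> l))"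
    using c Bc by (simp add: assoc_mult_mat[of _ n n _ n _ n])
  then show ?thesis
    using c Bc by (simp add: B_mat_mult[OF eta] B_mat_zero mult_2[symmetric])
qed

text \<open>As \<open>W\<close> is complex, taking complex parts entrywise commutes with
  multiplication by it and leaves a similarity between the diagonal matrices of cosh values.\<close>

lemma similarity_unique:
  assumes W: "W \<in> carrier_mat n n" and W': "W' \<in> carrier_mat n n" and inv: "W * W' = 1\<^sub>m n"
    and sim: "B_mat \<eta> n \<theta> * map_mat quat_of_complex W = map_mat quat_of_complex W * B_mat \<eta> n \<phi>"
  shows "image_mset (\<lambda>l. cosh (\<theta> l)) (mset_set {1..n div 2}) = image_mset (\<lambda>l. cosh (\<phi> l)) (mset_set {1..n div 2})"
proof -
  let ?C = "map_mat quat_of_complex" and ?B = "B_mat \<eta> n"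
  define D where "D \<psi> = mat n n (\<lambda>(i, j). if i = j then of_real (cosh_entry n \<psi> i) else (0::complex))" for \<psi>
  have D: "D \<psi> \<in> carrier_mat n n" for \<psi> by (simp add: D_def)
  have part: "complex_part (?B \<psi> $$ (i, j)) = D \<psi> $$ (i, j)" if "i < n" "j < n" for \<psi> i j
    using that complex_part_eta_real[OF eta] by (simp add: D_def B_mat_index)
  have "D \<theta> * W = W * D \<phi>"
  proof (rule eq_matI)
    fix i j assume "i < dim_row (W * D \<phi>)" "j < dim_col (W * D \<phi>)"
    then have ij: "i < n" "j < n" using W D[of \<phi>] by auto
    have "(D \<theta> * W) $$ (i, j) = complex_part ((?B \<theta> * ?C W) $$ (i, j))"
      using W ij D[of \<theta>]
      by (simp add: mat_mult_index[of _ n n _ n] complex_part_sum complex_part_mult_complex part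
          del: index_mult_mat)
    also have "\<dots> = complex_part ((?C W * ?B \<phi>) $$ (i, j))"
      by (simp only: sim)
    also have "\<dots> = (W * D \<phi>) $$ (i, j)"
      using W ij D[of \<phi>]
      by (simp add: mat_mult_index[of _ n n _ n] complex_part_sum complex_part_mult_complex part
          del: index_mult_mat)
    finally show "(D \<theta> * W) $$ (i, j) = (W * D \<phi>) $$ (i, j)" .
  qed (use W D[of \<theta>] D[of \<phi>] in auto)
  then have "D \<theta> * W * W' = W * D \<phi> * W'" by simp
  then have "D \<theta> = W * D \<phi> * W'"
    using inv by (simp add: assoc_mult_mat[OF D W W'] right_mult_one_mat[OF D])
  then have "similar_mat_wit (D \<theta>) (D \<phi>) W W'"
    using W W' D[of \<theta>] D[of \<phi>] inv mat_mult_left_right_inverse[OF W W' inv]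
    unfolding similar_mat_wit_def Let_def by auto
  then have "similar_mat (D \<theta>) (D \<phi>)" unfolding similar_mat_def by blast
  then have m1: "mset (diag_mat (D \<theta>)) = mset (diag_mat (D \<phi>))"
    by (intro similar_upper_triangular_diag[OF D D]) (auto simp: D_def)
  have m2: "diag_mat (D \<psi>) = map (\<lambda>l. of_real (if l = 0 then 1 else cosh (\<psi> l))) (map (blk n) [0..<n])" for \<psi>
    by (auto simp: diag_mat_def D_def cosh_entry_def)
  have m3: "mset (map (\<lambda>l. complex_of_real (if l = 0 then 1 else cosh (\<psi> l))) (map (blk n) [0..<n])) =
      image_mset complex_of_real ((if even n then {#} else {#1#}) +
        repeat_mset 2 (image_mset (\<lambda>l. cosh (\<psi> l)) (mset_set {1..n div 2})))" for \<psi>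
  proof -
    let ?g = "\<lambda>l. if l = 0 then 1 else cosh (\<psi> l)"
    have rep: "image_mset ?g (repeat_mset 2 X) = repeat_mset 2 (image_mset ?g X)" for X
      by (simp add: numeral_2_eq_2)
    have pos: "image_mset ?g (mset_set {1..n div 2}) = image_mset (\<lambda>l. cosh (\<psi> l)) (mset_set {1..n div 2})"
      by (rule image_mset_cong) auto
    have "mset (map (\<lambda>l. complex_of_real (?g l)) xs) = image_mset complex_of_real (image_mset ?g (mset xs))" for xs
      by (simp add: multiset.map_comp comp_def)
    moreover have "image_mset ?g (mset (map (blk n) [0..<n])) = (if even n then {#} else {#1#}) +
        repeat_mset 2 (image_mset (\<lambda>l. cosh (\<psi> l)) (mset_set {1..n div 2}))"
      unfolding mset_blk image_mset_union rep pos by simp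
    ultimately show ?thesis by (simp only:)
  qed
  \<comment> \<open>It remains to remove the embedding into the complex numbers, cancel the common
    leading 1, and halve the multiplicities.\<close>
  have "inj (image_mset complex_of_real)"
    by (intro multiset.inj_map injI) simp
  from injD[OF this m1[unfolded m2 m3]] show ?thesis
    unfolding add_left_cancel by (rule repeat_mset_cancel_pos[rotated]) simp
qed

text \<open>The unitary factor cancels, and the self-adjoint middle factor is squared, which doubles
  its parameters.\<close>

lemma gram_of_decomp:
  assumes "is_UBV_decomp \<eta> n G U \<theta> V"
  shows "qmat_adjoint G * G =
    qmat_adjoint (map_mat quat_of_complex V) * B_mat \<eta> n (\<lambda>l. 2 * \<theta> l) * map_mat quat_of_complex V"
proof -
  let ?V = "map_mat quat_of_complex V" and ?B = "B_mat \<eta> n \<theta>"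
  have U: "U \<in> carrier_mat n n" "qmat_adjoint U * U = 1\<^sub>m n" and V: "?V \<in> carrier_mat n n"
    and G: "G = U * ?B * ?V"
    using assms by (auto simp: is_UBV_decomp_def quat_unitary_def)
  have B: "?B \<in> carrier_mat n n" by simp
  define X where "X = ?B * ?V"
  have X: "X \<in> carrier_mat n n" unfolding X_def by (rule mult_carrier_mat[OF B V])
  have GX: "G = U * X" unfolding G X_def by (rule assoc_mult_mat[OF U(1) B V])
  have aX: "qmat_adjoint X = qmat_adjoint ?V * ?B"
    unfolding X_def qmat_adjoint_mult[OF B V] B_mat_adjoint[OF eta] ..
  have "qmat_adjoint G * G = qmat_adjoint X * qmat_adjoint U * (U * X)"
    unfolding GX qmat_adjoint_mult[OF U(1) X] ..
  also have "\<dots> = qmat_adjoint X * (qmat_adjoint U * (U * X))"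
    by (rule assoc_mult_mat) (use U X in auto)
  also have "qmat_adjoint U * (U * X) = qmat_adjoint U * U * X"
    by (rule assoc_mult_mat[symmetric]) (use U X in auto)
  also have "\<dots> = X" using U X by simp
  also have "qmat_adjoint X * X = qmat_adjoint ?V * (?B * X)"
    unfolding aX by (rule assoc_mult_mat) (use V B X in auto)
  also have "?B * X = ?B * ?B * ?V"
    unfolding X_def by (rule assoc_mult_mat[symmetric, OF B B V])
  also have "\<dots> = B_mat \<eta> n (\<lambda>l. 2 * \<theta> l) * ?V"
    unfolding B_mat_mult[OF eta] mult_2 ..
  also have "qmat_adjoint ?V * \<dots> = qmat_adjoint ?V * B_mat \<eta> n (\<lambda>l. 2 * \<theta> l) * ?V"
    by (rule assoc_mult_mat[symmetric]) (use V in auto)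
  finally show ?thesis .
qed

theorem UBV_decomp_unique:
  assumes d: "is_UBV_decomp \<eta> n G U \<theta> V" and d': "is_UBV_decomp \<eta> n G U' \<theta>' V'"
  shows "\<exists>p. p permutes {1..n div 2} \<and> (\<forall>l\<in>{1..n div 2}. \<theta>' l = \<theta> (p l) \<or> \<theta>' l = - \<theta> (p l))"
proof -
  let ?C = "map_mat quat_of_complex"
  have V: "V \<in> carrier_mat n n" "invertible_mat V" and V': "V' \<in> carrier_mat n n" "invertible_mat V'"
    using d d' by (auto simp: is_UBV_decomp_def)
  obtain R where R: "R \<in> carrier_mat n n" "V' * R = 1\<^sub>m n" "R * V' = 1\<^sub>m n"
    by (rule invertible_mat_inverse[OF V'])
  obtain S where S: "S \<in> carrier_mat n n" "V * S = 1\<^sub>m n" "S * V = 1\<^sub>m n"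
    by (rule invertible_mat_inverse[OF V])
  \<comment> \<open>\<open>W\<close> is \<open>V\<close> times the inverse of \<open>V'\<close>, the
    change of basis between the two factorisations of G^D G.\<close>
  define W W' where "W = V * R" and "W' = V' * S"
  have W: "W \<in> carrier_mat n n" "W' \<in> carrier_mat n n"
    using V V' R S by (auto simp: W_def W'_def)
  have "W * W' = V * (R * (V' * S))"
    unfolding W_def W'_def by (rule assoc_mult_mat) (use V V' R S in auto)
  also have "R * (V' * S) = R * V' * S"
    by (rule assoc_mult_mat[symmetric]) (use V' R S in auto)
  finally have WW': "W * W' = 1\<^sub>m n" using R S by simp
  have c: "?C V \<in> carrier_mat n n" "?C V' \<in> carrier_mat n n" "?C R \<in> carrier_mat n n" using V V' R by simp_all
  have CW: "?C W = ?C V * ?C R" unfolding W_def by (rule qc.mat_hom_mult[OF V(1) R(1)])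
  have VR: "?C V' * ?C R = 1\<^sub>m n"
    unfolding qc.mat_hom_mult[OF V'(1) R(1), symmetric] R(2) qc.mat_hom_one ..
  have sandwich: "qmat_adjoint (M * ?C R) * B * (M * ?C R) = qmat_adjoint (?C R) * (qmat_adjoint M * B * M) * ?C R"
    if M: "M \<in> carrier_mat n n" and B: "B \<in> carrier_mat n n" for M B
  proof -
    let ?M = "qmat_adjoint M" and ?R = "qmat_adjoint (?C R)"
    have a: "?M \<in> carrier_mat n n" "?R \<in> carrier_mat n n" using M c(3) by auto
    note a21 = mult_carrier_mat[OF a(2,1)] and a1B = mult_carrier_mat[OF a(1) B]
    have "qmat_adjoint (M * ?C R) * B * (M * ?C R) = ?R * ?M * B * (M * ?C R)"
      unfolding qmat_adjoint_mult[OF M c(3)] ..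
    also have "\<dots> = ?R * ?M * B * M * ?C R"
      by (rule assoc_mult_mat[symmetric, OF mult_carrier_mat[OF a21 B] M c(3)])
    also have "?R * ?M * B * M = ?R * (?M * B) * M"
      by (subst assoc_mult_mat[OF a(2,1) B]) simp
    also have "\<dots> = ?R * (?M * B * M)"
      by (rule assoc_mult_mat[OF a(2) a1B M])
    finally show ?thesis .
  qed
  let ?B = "\<lambda>\<theta>. B_mat \<eta> n (\<lambda>l. 2 * \<theta> l)"
  have "qmat_adjoint (?C W) * ?B \<theta> * ?C W = qmat_adjoint (?C R) * (qmat_adjoint G * G) * ?C R"
    unfolding CW gram_of_decomp[OF d] by (rule sandwich) (use c in simp_all)
  also have "\<dots> = qmat_adjoint (?C V' * ?C R) * ?B \<theta>' * (?C V' * ?C R)"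
    unfolding gram_of_decomp[OF d'] by (rule sandwich[symmetric]) (use c in simp_all)
  also have "\<dots> = ?B \<theta>'"
    unfolding VR by (simp add: left_mult_one_mat[OF B_mat_carrier] right_mult_one_mat[OF B_mat_carrier])
  \<comment> \<open>One doubling comes from the Gram matrix, the other from passing to a
    similarity.\<close>
  finally have "B_mat \<eta> n (\<lambda>l. 2 * (2 * \<theta> l)) * ?C W = ?C W * B_mat \<eta> n (\<lambda>l. 2 * (2 * \<theta>' l))"
    by (rule congruence_imp_similarity[OF W WW'])
  from similarity_unique[OF W WW' this]
  have "image_mset (\<lambda>l. cosh (2 * (2 * \<theta>' l))) (mset_set {1..n div 2}) =
    image_mset (\<lambda>l. cosh (2 * (2 * \<theta> l))) (mset_set {1..n div 2})" by simp
  from image_mset_eq_implies_permutes[OF _ this]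
  obtain p where p: "p permutes {1..n div 2}"
    "\<forall>l\<in>{1..n div 2}. cosh (2 * (2 * \<theta>' l)) = cosh (2 * (2 * \<theta> (p l)))"
    by auto
  \<comment> \<open>cosh determines its argument up to sign.\<close>
  then have "\<forall>l\<in>{1..n div 2}. \<theta>' l = \<theta> (p l) \<or> \<theta>' l = - \<theta> (p l)"
    by (auto simp: abs_mult abs_eq_iff)
  then show ?thesis using p(1) by blast
qed

end

section \<open>Existence\<close>

definition qform :: "nat \<Rightarrow> quat mat \<Rightarrow> (nat \<Rightarrow> quat) \<Rightarrow> (nat \<Rightarrow> quat) \<Rightarrow> quat" where
  "qform n H x y = (\<Sum>p<n. \<Sum>q<n. quat_cnj (x p) * H $$ (p, q) * y q)"

lemma qform_linear:
  "qform n H x (\<lambda>p. y p + z p * c) = qform n H x y + qform n H x z * c"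
  "qform n H (\<lambda>p. y p + z p * c) x = qform n H y x + quat_cnj c * qform n H z x"
  by (simp_all add: qform_def quat_cnj_add quat_cnj_mult ring_distribs sum.distrib sum_distrib_left
      sum_distrib_right mult.assoc)

lemma qform_scale:
  "qform n H (\<lambda>p. of_real c * x p) (\<lambda>p. of_real d * y p) = of_real (c * d) * qform n H x y"
proof -
  have "quat_cnj (of_real c * v) * h * (of_real d * w) = of_real (c * d) * (quat_cnj v * h * w)" for v h w
    by (simp add: quat_eq_iff algebra_simps)
  then show ?thesis by (simp add: qform_def sum_distrib_left)
qed

section \<open>Positivity of the Gram matrix\<close>

lemma gram_index:
  assumes "G \<in> carrier_mat n n" "p < n" "q < n"
  shows "(qmat_adjoint G * G) $$ (p, q) = (\<Sum>r<n. quat_cnj (G $$ (r, p)) * G $$ (r, q))"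
  using assms by (simp add: mat_mult_index[of _ n n _ n] del: index_mult_mat)

lemma gram_commute:
  assumes "G \<in> carrier_mat n n" "p < n" "q < n"
  shows "(qmat_adjoint G * G) $$ (q, p) = quat_cnj ((qmat_adjoint G * G) $$ (p, q))"
  unfolding gram_index[OF assms] gram_index[OF assms(1,3,2)]
  by (simp add: quat_cnj_sum quat_cnj_mult)

text \<open>Interchanging the sums groups the form as (G x)^D (G x), the squared norm of G
  x.\<close>

lemma qform_gram:
  assumes "G \<in> carrier_mat n n"
  shows "qform n (qmat_adjoint G * G) x x = of_real (\<Sum>r<n. quat_norm2 (\<Sum>p<n. G $$ (r, p) * x p))"
proof -
  have "qform n (qmat_adjoint G * G) x x =
    (\<Sum>p<n. \<Sum>q<n. \<Sum>r<n. quat_cnj (G $$ (r, p) * x p) * (G $$ (r, q) * x q))"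
    unfolding qform_def using assms
    by (intro sum.cong refl) (simp add: gram_index sum_distrib_left sum_distrib_right quat_cnj_mult mult.assoc
        del: index_mult_mat)
  also have "\<dots> = (\<Sum>p<n. \<Sum>r<n. \<Sum>q<n. quat_cnj (G $$ (r, p) * x p) * (G $$ (r, q) * x q))"
    by (intro sum.cong refl sum.swap)
  also have "\<dots> = (\<Sum>r<n. \<Sum>p<n. \<Sum>q<n. quat_cnj (G $$ (r, p) * x p) * (G $$ (r, q) * x q))"
    by (rule sum.swap)
  also have "\<dots> = (\<Sum>r<n. quat_cnj (\<Sum>p<n. G $$ (r, p) * x p) * (\<Sum>q<n. G $$ (r, q) * x q))"
    by (simp add: quat_cnj_sum sum_product)
  finally show ?thesis by (simp add: quat_cnj_mult_self)
qed

lemma invertible_apply_nonzero: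
  fixes G :: "'a::ring_1 mat"
  assumes G: "G \<in> carrier_mat n n" "invertible_mat G" and x: "\<exists>p<n. x p \<noteq> 0"
  shows "\<exists>r<n. (\<Sum>p<n. G $$ (r, p) * x p) \<noteq> 0"
proof (rule ccontr)
  assume "\<not> ?thesis"
  then have 0: "(\<Sum>p<n. G $$ (r, p) * x p) = 0" if "r < n" for r using that by blast
  obtain F where Fc: "F \<in> carrier_mat n n" and FG: "F * G = 1\<^sub>m n"
    by (rule invertible_mat_inverse[OF G])
  have "x p = 0" if p: "p < n" for p
  proof -
    have "x p = (\<Sum>q<n. if p = q then x q else 0)" using p by simp
    also have "\<dots> = (\<Sum>q<n. (F * G) $$ (p, q) * x q)"
      unfolding FG using p by (intro sum.cong refl) simp
    also have "\<dots> = (\<Sum>q<n. \<Sum>r<n. F $$ (p, r) * (G $$ (r, q) * x q))"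
      using p by (intro sum.cong refl) (simp add: mat_mult_index[OF Fc G(1)] sum_distrib_right mult.assoc
          del: index_mult_mat)
    also have "\<dots> = (\<Sum>r<n. \<Sum>q<n. F $$ (p, r) * (G $$ (r, q) * x q))"
      by (rule sum.swap)
    also have "\<dots> = (\<Sum>r<n. F $$ (p, r) * (\<Sum>q<n. G $$ (r, q) * x q))"
      by (simp add: sum_distrib_left)
    also have "\<dots> = 0" using 0 by simp
    finally show ?thesis .
  qed
  then show False using x by blast
qed

lemma qform_gram_pos:
  assumes "G \<in> carrier_mat n n" "invertible_mat G" "\<exists>p<n. x p \<noteq> 0"
  shows "0 < qRe (qform n (qmat_adjoint G * G) x x)"
proof -
  obtain r where "r < n" "(\<Sum>p<n. G $$ (r, p) * x p) \<noteq> 0"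
    using invertible_apply_nonzero[OF assms] by blast
  then have "0 < (\<Sum>r<n. quat_norm2 (\<Sum>p<n. G $$ (r, p) * x p))"
    by (intro sum_pos2[of _ r]) (auto simp: quat_norm2_pos quat_norm2_nonneg)
  then show ?thesis unfolding qform_gram[OF assms(1)] by (simp del: of_real_sum)
qed

lemma ex_tanh:
  fixes s :: real
  assumes "\<bar>s\<bar> < 1"
  obtains t where "cosh t * s = sinh t"
proof
  \<comment> \<open>The inverse hyperbolic tangent of \<open>s\<close>.\<close>
  define t where "t = ln ((1 + s) / (1 - s)) / 2"
  have "exp (- 2 * t) = inverse (exp (ln ((1 + s) / (1 - s))))"
    by (simp add: t_def exp_minus)
  also have "\<dots> = (1 - s) / (1 + s)" using assms by simp
  finally have e: "exp (- 2 * t) = (1 - s) / (1 + s)" .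
  have "tanh t = s" unfolding tanh_real_altdef e using assms by (simp add: field_simps)
  then have "sinh t / cosh t = s" by (simp add: tanh_def)
  then show "cosh t * s = sinh t" by (simp add: field_simps)
qed

lemma blk_0_iff: "blk n i = 0 \<longleftrightarrow> odd n \<and> i = 0"
  by (cases "even n") (auto simp: blk_def even_iff_mod_2_eq_zero odd_iff_mod_2_eq_one)

lemma blk_le: "i < n \<Longrightarrow> blk n i \<le> n div 2"
proof -
  assume "i < n"
  have "n = 2 * (n div 2) + n mod 2" by simp
  then have "i + 2 - n mod 2 < 2 * (n div 2) + 2" using \<open>i < n\<close> by linarith
  then show ?thesis unfolding blk_def by linarith
qed

lemma ex_blk:
  assumes "l \<in> {1..n div 2}"
  obtains i where "Suc i < n" "blk n i = l" "blk n (Suc i) = l"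
proof
  define i where "i = 2 * (l - 1) + n mod 2"
  have n: "n = 2 * (n div 2) + n mod 2" by simp
  have "1 \<le> l" "l \<le> n div 2" using assms by simp_all
  then show "Suc i < n" unfolding i_def using n by linarith
  show "blk n i = l" "blk n (Suc i) = l" using assms by (auto simp: blk_def i_def)
qed

context
  fixes \<eta> :: quat
  assumes eta: "\<eta> \<in> {quat_j, quat_k}"
begin

text \<open>The second part of the form is conjugate-linear in both arguments. Conjugating it,
  already in \<open>B\<close>, yields the bilinear form needed by
  \<open>hermitian_skew_pair\<close>.\<close>

lemma qform_complex:
  fixes H n
  defines "A \<equiv> \<lambda>p q. complex_part (H $$ (p, q))" and "B \<equiv> \<lambda>p q. cnj (second_part \<eta> (H $$ (p, q)))"
  shows "qform n H (\<lambda>p. quat_of_complex (x p)) (\<lambda>p. quat_of_complex (y p)) =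
    quat_of_complex (sesq n A x y) + quat_of_complex (cnj (bilin n B x y)) * \<eta>"
proof -
  let ?q = "qform n H (\<lambda>p. quat_of_complex (x p)) (\<lambda>p. quat_of_complex (y p))"
  have "complex_part ?q = sesq n A x y"
    unfolding qform_def sesq_def A_def
    by (simp add: complex_part_sum complex_part_mult_complex flip: quat_of_complex_cnj)
  moreover have "second_part \<eta> ?q = cnj (bilin n B x y)"
    unfolding qform_def bilin_def B_def
    by (simp add: second_part_sum[OF eta] second_part_mult_complex[OF eta] flip: quat_of_complex_cnj)
  ultimately show ?thesis using quat_parts[OF eta, of ?q] by simp
qed

text \<open>The canonical basis for the two complex forms also describes the quaternionic form.
  Positivity on genuinely quaternionic combinations of a pair bounds \<open>s\<close> by 1.\<close>

lemma ex_tanh_basis: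
  assumes G: "G \<in> carrier_mat n n" "invertible_mat G"
  defines "H \<equiv> qmat_adjoint G * G"
  obtains u s where
    "\<And>i j. i < n \<Longrightarrow> j < n \<Longrightarrow>
      qform n H (\<lambda>p. quat_of_complex (u i p)) (\<lambda>p. quat_of_complex (u j p)) =
      (if i = j then 1 else of_real (skew_entry n s i j) * \<eta>)"
    "\<And>l. l \<in> {1..n div 2} \<Longrightarrow> \<bar>s l\<bar> < 1"
proof -
  define A where "A = (\<lambda>p q. complex_part (H $$ (p, q)))"
  define B where "B = (\<lambda>p q. cnj (second_part \<eta> (H $$ (p, q))))"
  note qc_form = qform_complex[of n H, folded A_def B_def]
  interpret hermitian_skew_pair n A B
  proof
    fix p q assume pq: "p < n" "q < n"
    show "A q p = cnj (A p q)" "B q p = - B p q"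
      unfolding A_def B_def H_def gram_commute[OF G(1) pq]
      by (simp_all add: complex_part_cnj second_part_cnj[OF eta])
  next
    fix x :: "nat \<Rightarrow> complex" assume x: "\<exists>i<n. x i \<noteq> 0"
    have "complex_part (qform n H (\<lambda>p. quat_of_complex (x p)) (\<lambda>p. quat_of_complex (x p))) = sesq n A x x"
      unfolding qform_def sesq_def A_def
      by (simp add: complex_part_sum complex_part_mult_complex flip: quat_of_complex_cnj)
    moreover have "0 < qRe (qform n H (\<lambda>p. quat_of_complex (x p)) (\<lambda>p. quat_of_complex (x p)))"
      unfolding H_def by (rule qform_gram_pos[OF G]) (use x in simp)
    ultimately show "0 < Re (sesq n A x x)" by (metis complex_part_sel(1))
  qed
  obtain u s where u: "\<And>i j. i < n \<Longrightarrow> j < n \<Longrightarrow> a (u i) (u j) = (if i = j then 1 else 0)"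
    "\<And>i j. i < n \<Longrightarrow> j < n \<Longrightarrow> b (u i) (u j) = of_real (skew_entry n s i j)"
    and s: "\<And>l. l \<in> {1..n div 2} \<Longrightarrow> 0 \<le> s l"
    using ex_canonical_basis by metis
  have entries: "qform n H (\<lambda>p. quat_of_complex (u i p)) (\<lambda>p. quat_of_complex (u j p)) =
      (if i = j then 1 else of_real (skew_entry n s i j) * \<eta>)" if "i < n" "j < n" for i j
    unfolding qc_form u(1)[OF that] u(2)[OF that] by (simp add: skew_entry_def)
  show thesis
  proof (rule that[OF entries])
    fix l assume l: "l \<in> {1..n div 2}"
    obtain i where i: "Suc i < n" "blk n i = l" "blk n (Suc i) = l" using ex_blk[OF l] .
    let ?x = "\<lambda>p. quat_of_complex (u i p)" and ?y = "\<lambda>p. quat_of_complex (u (Suc i) p)"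
    \<comment> \<open>The test vector for the bound: the form has the value 2 - 2 \<open>s l\<close>
      on it. It is nonzero because its complex part is \<open>u i\<close>.\<close>
    let ?z = "\<lambda>p. ?x p + ?y p * \<eta>"
    have "\<exists>p<n. u i p \<noteq> 0"
    proof (rule ccontr)
      assume "\<not> ?thesis"
      then have "a (u i) (u i) = 0" by (simp add: sesq_def)
      then show False using u(1)[of i i] i(1) by simp
    qed
    moreover have "complex_part (?z p) = u i p" for p
      using eta by (auto simp: complex_eq_iff quat_j_def quat_k_def)
    ultimately have "\<exists>p<n. ?z p \<noteq> 0" by (metis complex_part_0)
    from qform_gram_pos[OF G this] have "0 < qRe (qform n H ?z ?z)" by (simp add: H_def)
    also have "qform n H ?z ?z = 1 + of_real (s l) * \<eta> * \<eta> +
      quat_cnj \<eta> * (of_real (- s l) * \<eta> + 1 * \<eta>)"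
      unfolding qform_linear using entries[of i i] entries[of i "Suc i"] entries[of "Suc i" i]
        entries[of "Suc i" "Suc i"] i by (simp add: skew_entry_def ring_distribs mult.assoc)
    also have "qRe \<dots> = 2 - 2 * s l"
      using eta by (auto simp: quat_j_def quat_k_def)
    finally show "\<bar>s l\<bar> < 1" using s[OF l] by simp
  qed
qed

theorem UBV_decomp_exists:
  assumes G: "G \<in> carrier_mat n n" "invertible_mat G"
  shows "\<exists>U \<theta> V. is_UBV_decomp \<eta> n G U \<theta> V"
proof -
  define H where "H = qmat_adjoint G * G"
  let ?C = "map_mat quat_of_complex"
  let ?qc = "\<lambda>x p. quat_of_complex (x p)"
  obtain u s where u: "\<And>i j. i < n \<Longrightarrow> j < n \<Longrightarrow> qform n H (?qc (u i)) (?qc (u j)) =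
      (if i = j then 1 else of_real (skew_entry n s i j) * \<eta>)"
    and s: "\<And>l. l \<in> {1..n div 2} \<Longrightarrow> \<bar>s l\<bar> < 1"
    using ex_tanh_basis[OF G] unfolding H_def by metis
  have "\<forall>l. \<exists>t. l \<in> {1..n div 2} \<longrightarrow> cosh t * s l = sinh t"
    using s ex_tanh by metis
  then obtain t where t: "\<And>l. l \<in> {1..n div 2} \<Longrightarrow> cosh (t l) * s l = sinh (t l)"
    by metis
  \<comment> \<open>The middle factor enters the Gram matrix squared, so the decomposition needs
    half the parameters.\<close>
  define \<theta> where "\<theta> l = t l / 2" for l
  \<comment> \<open>Scaling both vectors of a pair by sqrt (cosh t) turns the entries 1 and
    \<open>s\<close> of the form into cosh t and cosh t * \<open>s\<close> = sinh t.\<close>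
  define d where "d i = sqrt (cosh_entry n t i)" for i
  have dpos: "0 < d i" "d i * d i = cosh_entry n t i" for i
    by (simp_all add: d_def cosh_entry_def)
  define w where "w i p = of_real (d i) * u i p" for i p
  have w: "qform n H (?qc (w i)) (?qc (w j)) = B_mat \<eta> n t $$ (i, j)" if ij: "i < n" "j < n" for i j
  proof -
    have "qform n H (?qc (w i)) (?qc (w j)) = of_real (d i * d j) * qform n H (?qc (u i)) (?qc (u j))"
      unfolding w_def qc.hom_mult quat_of_complex_of_real by (rule qform_scale)
    also have "\<dots> = B_mat \<eta> n t $$ (i, j)"
    proof (cases "i = j")
      case True
      then show ?thesis using ij u[OF ij] dpos(2)[of j] by (simp add: B_mat_index)
    next
      case False
      have "d i * d j * skew_entry n s i j = skew_entry n (\<lambda>l. sinh (t l)) i j"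
      proof (cases "blk n i = blk n j")
        case True
        then have "blk n i \<noteq> 0" using False blk_0_iff[of n i] blk_0_iff[of n j] by auto
        then have l: "blk n i \<in> {1..n div 2}" using blk_le[OF ij(1)] by simp
        have "d i = d j" using True by (simp add: d_def cosh_entry_def)
        then have "d i * d j = cosh (t (blk n i))"
          using dpos(2)[of i] \<open>blk n i \<noteq> 0\<close> by (simp add: cosh_entry_def)
        then show ?thesis using t[OF l] False True by (simp add: skew_entry_def)
      qed (simp add: skew_entry_def)
      then have "of_real (d i * d j) * (of_real (skew_entry n s i j) * \<eta>) =
        \<eta> * of_real (skew_entry n (\<lambda>l. sinh (t l)) i j)"
        by (metis mult.assoc of_real_mult of_real_mult_commute_quat)
      then show ?thesis using False ij u[OF ij] by (simp add: B_mat_index)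
    qed
    finally show ?thesis .
  qed
  define Q where "Q = mat n n (\<lambda>(p, i). w i p)"
  have Q: "Q \<in> carrier_mat n n" "?C Q \<in> carrier_mat n n" by (simp_all add: Q_def)
  have aQ: "qmat_adjoint (?C Q) \<in> carrier_mat n n" using Q by simp
  have aG: "qmat_adjoint G \<in> carrier_mat n n" using G by simp
  have H: "H \<in> carrier_mat n n" unfolding H_def by (rule mult_carrier_mat[OF aG G(1)])
  have QHQ: "qmat_adjoint (?C Q) * H * ?C Q = B_mat \<eta> n t"
  proof (rule eq_matI)
    fix i j assume "i < dim_row (B_mat \<eta> n t)" "j < dim_col (B_mat \<eta> n t)"
    then have ij: "i < n" "j < n" using carrier_matD[OF B_mat_carrier[of \<eta> n t]] by simp_all
    have "(qmat_adjoint (?C Q) * H * ?C Q) $$ (i, j) = qform n H (?qc (w i)) (?qc (w j))"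
      unfolding mat_triple_index[OF aQ H Q(2) ij] qform_def
      using ij by (intro sum.cong refl) (simp add: Q_def)
    then show "(qmat_adjoint (?C Q) * H * ?C Q) $$ (i, j) = B_mat \<eta> n t $$ (i, j)"
      using w[OF ij] by simp
  qed (use carrier_matD[OF B_mat_carrier[of \<eta> n t]] Q in simp_all)
  \<comment> \<open>The complex part of \<open>QHQ\<close> says that Q^* A Q is diagonal with the
    positive entries \<open>cosh_entry\<close>, where A is the complex part of \<open>H\<close> and
    Q^* the conjugate transpose. Dividing Q^* A by these entries inverts \<open>Q\<close>.\<close>
  define V where "V = mat n n (\<lambda>(i, q). (\<Sum>p<n. cnj (w i p) * complex_part (H $$ (p, q))) / of_real (cosh_entry n t i))"
  have V: "V \<in> carrier_mat n n" by (simp add: V_def)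
  have VQ: "V * Q = 1\<^sub>m n"
  proof (rule eq_matI)
    fix i j assume "i < dim_row (1\<^sub>m n :: complex mat)" "j < dim_col (1\<^sub>m n :: complex mat)"
    then have ij: "i < n" "j < n" by simp_all
    have "(V * Q) $$ (i, j) = (\<Sum>q<n. \<Sum>p<n. cnj (w i p) * complex_part (H $$ (p, q)) * w j q) / of_real (cosh_entry n t i)"
      unfolding mat_mult_index[OF V Q(1) ij]
      using ij by (simp add: V_def Q_def sum_distrib_right sum_divide_distrib)
    also have "(\<Sum>q<n. \<Sum>p<n. cnj (w i p) * complex_part (H $$ (p, q)) * w j q) =
      (\<Sum>p<n. \<Sum>q<n. cnj (w i p) * complex_part (H $$ (p, q)) * w j q)"
      by (rule sum.swap)
    also have "\<dots> = complex_part (qform n H (?qc (w i)) (?qc (w j)))"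
      unfolding qform_def
      by (simp add: complex_part_sum complex_part_mult_complex flip: quat_of_complex_cnj)
    also have "\<dots> = (if i = j then of_real (cosh_entry n t i) else 0)"
      using ij by (simp add: w B_mat_index complex_part_eta_real[OF eta])
    finally show "(V * Q) $$ (i, j) = 1\<^sub>m n $$ (i, j)"
      using ij dpos(1)[of i] dpos(2)[of i] by (auto simp: cosh_entry_def)
  qed (use V Q in simp_all)
  have QV: "Q * V = 1\<^sub>m n" by (rule mat_mult_left_right_inverse[OF V Q(1) VQ])
  have invV: "invertible_mat V"
    unfolding invertible_mat_def inverts_mat_def using V Q VQ QV by auto
  define X where "X = G * ?C Q"
  have X: "X \<in> carrier_mat n n" unfolding X_def by (rule mult_carrier_mat[OF G(1) Q(2)])
  have "qmat_adjoint X * X = qmat_adjoint (?C Q) * qmat_adjoint G * (G * ?C Q)"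
    unfolding X_def qmat_adjoint_mult[OF G(1) Q(2)] ..
  also have "\<dots> = qmat_adjoint (?C Q) * (qmat_adjoint G * (G * ?C Q))"
    by (rule assoc_mult_mat[OF aQ aG X[unfolded X_def]])
  also have "qmat_adjoint G * (G * ?C Q) = H * ?C Q"
    unfolding H_def by (rule assoc_mult_mat[symmetric, OF aG G(1) Q(2)])
  also have "qmat_adjoint (?C Q) * \<dots> = qmat_adjoint (?C Q) * H * ?C Q"
    by (rule assoc_mult_mat[symmetric, OF aQ H Q(2)])
  finally have XX: "qmat_adjoint X * X = B_mat \<eta> n t" using QHQ by simp
  let ?B = "B_mat \<eta> n"
  have Bc: "?B \<phi> \<in> carrier_mat n n" for \<phi> by simp
  \<comment> \<open>\<open>X\<close> has Gram matrix B(t) = B(2 \<theta>), so multiplying by B(-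
    \<theta>) on the right makes it unitary.\<close>
  define U where "U = X * ?B (\<lambda>l. - \<theta> l)"
  have U: "U \<in> carrier_mat n n" unfolding U_def by (rule mult_carrier_mat[OF X Bc])
  have aX: "qmat_adjoint X \<in> carrier_mat n n" using X by simp
  have "qmat_adjoint U * U = ?B (\<lambda>l. - \<theta> l) * qmat_adjoint X * (X * ?B (\<lambda>l. - \<theta> l))"
    unfolding U_def qmat_adjoint_mult[OF X Bc] B_mat_adjoint[OF eta] ..
  also have "\<dots> = ?B (\<lambda>l. - \<theta> l) * (qmat_adjoint X * (X * ?B (\<lambda>l. - \<theta> l)))"
    by (rule assoc_mult_mat[OF Bc aX U[unfolded U_def]])
  also have "qmat_adjoint X * (X * ?B (\<lambda>l. - \<theta> l)) = ?B t * ?B (\<lambda>l. - \<theta> l)"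
    unfolding XX[symmetric] by (rule assoc_mult_mat[symmetric, OF aX X Bc])
  also have "?B (\<lambda>l. - \<theta> l) * (?B t * ?B (\<lambda>l. - \<theta> l)) = ?B (\<lambda>l. - \<theta> l + (t l + - \<theta> l))"
    unfolding B_mat_mult[OF eta] ..
  also have "(\<lambda>l. - \<theta> l + (t l + - \<theta> l)) = (\<lambda>_. 0)" by (simp add: \<theta>_def)
  finally have unitary: "quat_unitary n U" using U by (simp add: quat_unitary_def B_mat_zero)
  have "U * ?B \<theta> = X * (?B (\<lambda>l. - \<theta> l) * ?B \<theta>)"
    unfolding U_def by (rule assoc_mult_mat[OF X Bc Bc])
  also have "\<dots> = X" using right_mult_one_mat[OF X] by (simp add: B_mat_mult[OF eta] B_mat_zero)
  finally have "U * ?B \<theta> * ?C V = G * ?C Q * ?C V" by (simp add: X_def)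
  also have "\<dots> = G * (?C Q * ?C V)"
    by (rule assoc_mult_mat[OF G(1) Q(2)]) (use V in simp)
  also have "?C Q * ?C V = 1\<^sub>m n"
    using qc.mat_hom_mult[OF Q(1) V] QV qc.mat_hom_one by simp
  finally have "G = U * ?B \<theta> * ?C V" using right_mult_one_mat[OF G(1)] by simp
  then have "is_UBV_decomp \<eta> n G U \<theta> V"
    unfolding is_UBV_decomp_def using unitary V invV by simp
  then show ?thesis by blast
qed

end

theorem theorem5p13:
  fixes n m :: nat and \<eta> :: quat and G :: "quat mat"
  assumes "m = n div 2"
    and "\<eta> \<in> {quat_j, quat_k}"
    and "G \<in> carrier_mat n n" and "invertible_mat G"
  shows "\<exists>U V \<theta>. is_UBV_decomp \<eta> n G U \<theta> V \<and>
    (\<forall>U' V' \<theta>'. is_UBV_decomp \<eta> n G U' \<theta>' V' \<longrightarrow>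
      (\<exists>p. p permutes {1..m} \<and>
        (\<forall>l\<in>{1..m}. \<theta>' l = \<theta> (p l) \<or> \<theta>' l = - \<theta> (p l))))"
  using UBV_decomp_exists[OF assms(2-4)] UBV_decomp_unique[OF assms(2)] unfolding assms(1) by blast

end
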